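(* Let $C,\delta>0$. For every $\varepsilon>4\delta$ there exists $n_0$ such that for all $n\ge n_0$ the following holds. If $G$ is a $C$-Ramsey graph on $n$ vertices and $\omega\colon V(G)\to\{0,1,\dots,\lfloor n^{1+\delta}\rfloor\}$ is an injective weight function, then \[|\Psi(G,\omega)|\ge n^{3-\varepsilon},\] where $\Psi(G,\omega)=\{(v(H),\, e(H)+\sum_{x\in V(H)}\omega(x)) : H \text{ is an induced subgraph of } G\}$.
   Context: All logarithms are base $2$. A set of vertices is homogeneous if it induces a clique or an independent set; a graph $G$ on $n$ vertices is $C$-Ramsey if every homogeneous set of $G$ has size at most $C\log n$. For a graph $H$, $v(H)$ and $e(H)$ denote its numbers of vertices and edges. *)

theory Defs
  imports Complex_Main "HOL-Library.Ramsey"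
begin

text \<open>A graph is a pair of a vertex set and a set of edges, each edge being a two-element set of
  vertices.\<close>

type_synonym 'a ugraph = "'a set \<times> 'a set set"

abbreviation verts :: "'a ugraph \<Rightarrow> 'a set" where
  "verts G \<equiv> fst G"

abbreviation edges :: "'a ugraph \<Rightarrow> 'a set set" where
  "edges G \<equiv> snd G"

definition simple_graph :: "'a ugraph \<Rightarrow> bool" where
  "simple_graph G \<longleftrightarrow> finite (verts G) \<and> edges G \<subseteq> [verts G]\<^bsup>2\<^esup>"

definition induced_subgraph :: "'a ugraph \<Rightarrow> 'a ugraph \<Rightarrow> bool" where
  "induced_subgraph H G \<longleftrightarrow> verts H \<subseteq> verts G \<and> edges H = {e \<in> edges G. e \<subseteq> verts H}"

definition homogeneous :: "'a ugraph \<Rightarrow> 'a set \<Rightarrow> bool" where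
  "homogeneous G S \<longleftrightarrow> S \<subseteq> verts G \<and> (clique S (edges G) \<or> indep S (edges G))"

definition ramsey_graph :: "real \<Rightarrow> 'a ugraph \<Rightarrow> bool" where
  "ramsey_graph C G \<longleftrightarrow>
     (\<forall>S. homogeneous G S \<longrightarrow> real (card S) \<le> C * log 2 (real (card (verts G))))"

definition Psi :: "'a ugraph \<Rightarrow> ('a \<Rightarrow> nat) \<Rightarrow> (nat \<times> nat) set" where
  "Psi G \<omega> = {(card (verts H), card (edges H) + (\<Sum>x\<in>verts H. \<omega> x)) | H. induced_subgraph H G}"

text \<open>For a graph with finite vertex set, the cardinality of \<^const>\<open>Psi\<close> is a genuine one, not the
  default value \<open>0\<close> of \<^const>\<open>card\<close> on infinite sets.\<close>

lemma finite_Psi: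
  assumes "simple_graph G"
  shows "finite (Psi G \<omega>)"
proof -
  have "Psi G \<omega> \<subseteq> (\<lambda>U. (card U, card {e \<in> edges G. e \<subseteq> U} + sum \<omega> U)) ` Pow (verts G)"
    unfolding Psi_def induced_subgraph_def by auto
  moreover have "finite (Pow (verts G))"
    using assms by (simp add: simple_graph_def)
  ultimately show ?thesis
    by (rule finite_surj[rotated])
qed

end

theory Submission
  imports Defs "HOL-Library.FuncSet" "HOL-Real_Asymp.Real_Asymp"
begin

text \<open>Write \<open>val X = e(X) + \<omega>(X)\<close>; adding a vertex \<open>y\<close> to \<open>X\<close> raises it by \<open>deg X y + \<omega> y\<close>. All losses
  of the form \<open>n^\<eta>\<close> with small \<open>\<eta>\<close> are harmless. Since \<open>G\<close> is Ramsey, some \<open>W\<close> with \<open>|W| \<ge> n^(1 - \<eta>)\<close>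
  contains no complete or empty pair \<open>(S, A)\<close> with \<open>|S| \<ge> n^\<eta>\<close> and \<open>|A| \<ge> |W| / 32\<close>, so every vertex has fewer than
  \<open>n^\<eta>\<close> near-twins in \<open>W\<close>. Let \<open>V1\<close> and \<open>V2\<close> be the eighths of \<open>W\<close> of smallest and of largest weight
  and \<open>Y\<close> the rest. Random labels on \<open>V1 \<union> V2\<close> give increasing chains \<open>A i \<subseteq> V1\<close>, \<open>B j \<subseteq> V2\<close> of
  random sets with densities linear in \<open>i\<close> and \<open>j\<close>.

  For fixed \<open>|A i| + |B j|\<close> the value of \<open>A i \<union> B j\<close> is strictly monotone in \<open>i\<close> with steps of order
  \<open>|W|\<close>: the weight gap between \<open>V1\<close> and \<open>V2\<close> beats the change in the number of edges. As the weights are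
  at most \<open>n^(1 + \<delta>)\<close>, a point \<open>(k, v)\<close> therefore has the form \<open>A i \<union> B j \<union> {y}\<close> for about \<open>n^\<delta>\<close> pairs
  \<open>(i, j)\<close> only. It remains to see that \<open>y \<mapsto> deg (A i \<union> B j) y + \<omega> y\<close> has \<open>n^(1 - O(\<eta>))\<close> values on average.
  A collision of \<open>y\<close> and \<open>y'\<close> that are not near-twins asks a signed sum of independent indicators to equal
  \<open>m = \<omega> y' - \<omega> y\<close>. This has probability about \<open>n^(-1/2)\<close> at most, by Littlewood--Offord, and
  negligible probability unless the mean is within \<open>R = n^(1/2 + \<eta>)\<close> of \<open>m\<close>, by a Chernoff bound. The mean is
  linear in \<open>(i, j)\<close>, so the latter happens for a fraction about \<open>R / |m|\<close> of the pairs \<open>(i, j)\<close>. As \<open>\<omega>\<close> is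
  injective, the sum of \<open>1 / |m|\<close> over \<open>y'\<close> is logarithmic, and there are about \<open>n^(1 + O(\<eta>))\<close> collisions.\<close>

subsection \<open>Sums over independent random labels\<close>

text \<open>For negative \<open>z\<close> this follows from
  \<open>1 \<le> 1 - z^3 = (1 - z) (1 + z + z^2)\<close> and
  \<open>1 - z \<le> exp (- z)\<close>.\<close>

lemma exp_le_quadratic:
  fixes z :: real
  assumes "\<bar>z\<bar> \<le> 1"
  shows "exp z \<le> 1 + z + z\<^sup>2"
proof (cases "z \<ge> 0")
  case True
  then show ?thesis using exp_bound assms by auto
next
  case False
  have "1 - z \<le> exp (- z)" using exp_ge_add_one_self[of "-z"] by simp
  moreover have "(1 - z) * (1 + z + z\<^sup>2) = 1 - z^3"
    by (simp add: algebra_simps power2_eq_square power3_eq_cube)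
  moreover have "z ^ 3 \<le> 0" using False by (simp add: power_le_zero_eq)
  moreover have p: "1 + z + z\<^sup>2 \<ge> 0"
    using assms zero_le_power2[of z] by (simp add: abs_if split: if_splits)
  ultimately have "1 \<le> exp (- z) * (1 + z + z\<^sup>2)"
    using mult_right_mono[of "1 - z" "exp (-z)" "1 + z + z\<^sup>2"] by linarith
  then show ?thesis by (simp add: exp_minus field_simps)
qed

text \<open>Labellings in \<open>U \<rightarrow>\<^sub>E L\<close> serve as a uniform product space,
  so probabilities appear as counts out of \<open>card L ^ card U\<close>. The exponential moment
  factorises over \<open>U\<close>, and in each factor the linear term vanishes by
  \<open>h0\<close>.\<close>

lemma PiE_upper_tail:
  fixes h :: "'a \<Rightarrow> 'b \<Rightarrow> real"
  assumes fin: "finite U" "finite L"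
    and h1: "\<And>x y. x \<in> U \<Longrightarrow> y \<in> L \<Longrightarrow> \<bar>h x y\<bar> \<le> 1"
    and h0: "\<And>x. x \<in> U \<Longrightarrow> (\<Sum>y\<in>L. h x y) = 0"
    and R: "0 \<le> R" "R \<le> 2 * real (card U)"
  shows "real (card {l \<in> U \<rightarrow>\<^sub>E L. R \<le> (\<Sum>x\<in>U. h x (l x))})
           \<le> exp (- (R\<^sup>2 / (4 * card U))) * real (card L) ^ card U"
proof (cases "U = {}")
  case True
  have "card {l \<in> U \<rightarrow>\<^sub>E L. R \<le> (\<Sum>x\<in>U. h x (l x))} \<le> card (U \<rightarrow>\<^sub>E L)"
    by (rule card_mono) (auto simp: fin finite_PiE)
  then show ?thesis using True by simp
next
  case False
  define u where "u = real (card U)"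
  \<comment> \<open>This \<open>t\<close> minimises \<open>t^2 * u - t * R\<close>; the hypothesis
    \<open>R \<le> 2 * card U\<close> keeps it at most 1, as the quadratic bound on
    \<open>exp\<close> requires.\<close>
  define t where "t = R / (2 * u)"
  have u: "u > 0" using False fin by (simp add: u_def card_gt_0_iff)
  have t: "0 \<le> t" "t \<le> 1" using R u by (auto simp: t_def u_def[symmetric] divide_simps)
  let ?S = "{l \<in> U \<rightarrow>\<^sub>E L. R \<le> (\<Sum>x\<in>U. h x (l x))}"
  have "real (card ?S) * exp (t * R) = (\<Sum>l\<in>?S. exp (t * R))" by simp
  also have "\<dots> \<le> (\<Sum>l\<in>?S. exp (t * (\<Sum>x\<in>U. h x (l x))))"
    by (rule sum_mono) (use t in \<open>auto intro!: mult_left_mono\<close>)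
  also have "\<dots> \<le> (\<Sum>l\<in>U \<rightarrow>\<^sub>E L. exp (t * (\<Sum>x\<in>U. h x (l x))))"
    by (rule sum_mono2) (auto simp: fin finite_PiE)
  also have "\<dots> = (\<Sum>l\<in>U \<rightarrow>\<^sub>E L. \<Prod>x\<in>U. exp (t * h x (l x)))"
    by (simp add: sum_distrib_left exp_sum fin)
  also have "\<dots> = (\<Prod>x\<in>U. \<Sum>y\<in>L. exp (t * h x y))"
    by (rule prod_sum_PiE[symmetric]) (auto simp: fin)
  also have "\<dots> \<le> (\<Prod>x\<in>U. real (card L) * exp (t\<^sup>2))"
  proof (rule prod_mono, intro conjI sum_nonneg exp_ge_zero)
    fix x assume x: "x \<in> U"
    have "(\<Sum>y\<in>L. exp (t * h x y)) \<le> (\<Sum>y\<in>L. (1 + t\<^sup>2) + t * h x y)"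
    proof (rule sum_mono)
      fix y assume y: "y \<in> L"
      have a: "\<bar>t * h x y\<bar> \<le> t" "\<bar>t * h x y\<bar> \<le> 1" using h1[OF x y] t
        by (auto simp: abs_mult mult_le_one intro: mult_left_le)
      have "(t * h x y)\<^sup>2 \<le> t\<^sup>2" using a t by (intro abs_le_square_iff[THEN iffD1]) auto
      then show "exp (t * h x y) \<le> (1 + t\<^sup>2) + t * h x y" using exp_le_quadratic[OF a(2)] by linarith
    qed
    also have "\<dots> = real (card L) * (1 + t\<^sup>2)"
      by (simp add: sum.distrib h0[OF x] flip: sum_distrib_left)
    also have "\<dots> \<le> real (card L) * exp (t\<^sup>2)"
      by (intro mult_left_mono exp_ge_add_one_self) simp
    finally show "(\<Sum>y\<in>L. exp (t * h x y)) \<le> real (card L) * exp (t\<^sup>2)" .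
  qed
  also have "\<dots> = real (card L) ^ card U * exp (t\<^sup>2 * u)"
    by (simp add: power_mult_distrib u_def exp_of_nat_mult[symmetric] mult.commute)
  finally have "real (card ?S) \<le> real (card L) ^ card U * exp (t\<^sup>2 * u) / exp (t * R)"
    by (simp add: field_simps)
  also have "\<dots> = real (card L) ^ card U * exp (t\<^sup>2 * u - t * R)" by (simp add: exp_diff)
  also have "t\<^sup>2 * u - t * R = - (R\<^sup>2 / (4 * u))"
    using u by (simp add: t_def field_simps power2_eq_square)
  finally show ?thesis by (simp add: u_def mult.commute)
qed

section \<open>Binomial coefficients and the Littlewood--Offord bound\<close>

text \<open>Consecutive central coefficients have ratio \<open>2 (2m + 1) / (m + 1)\<close>, and
  \<open>(2m + 1) (2m + 3) \<le> 4 (m + 1)^2\<close> closes the induction.\<close>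

lemma central_binomial_sq_le: "(2 * m choose m)\<^sup>2 * (2 * m + 1) \<le> 16 ^ m"
proof (induction m)
  case (Suc m)
  let ?c = "2 * m choose m" and ?d = "2 * Suc m choose Suc m"
  have eq: "Suc m * ?d = 2 * (2 * m + 1) * ?c"
  proof -
    have "Suc m * (Suc (2*m+1) choose Suc m) = Suc (2*m+1) * ((2*m+1) choose m)"
      by (rule Suc_times_binomial)
    moreover have "(2*m+1) choose m = (2*m+1) choose Suc m"
      by (subst binomial_symmetric) auto
    moreover have "Suc m * (Suc (2*m) choose Suc m) = Suc (2*m) * (2*m choose m)"
      by (rule Suc_times_binomial)
    moreover have "2 * Suc m = Suc (2*m+1)" "Suc (2*m+1) = 2 * Suc m" by simp_all
    ultimately have "Suc m * ?d = 2 * (Suc m * (Suc (2*m) choose Suc m))"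
      by (metis Suc_eq_plus1 mult.assoc)
    also have "\<dots> = 2 * (Suc (2*m) * ?c)" by (simp only: Suc_times_binomial)
    also have "\<dots> = 2 * (2 * m + 1) * ?c" by simp
    finally show ?thesis .
  qed
  have "(Suc m)\<^sup>2 * (?d\<^sup>2 * (2 * Suc m + 1)) = (Suc m * ?d)\<^sup>2 * (2*m+3)"
    by (simp add: power_mult_distrib del: binomial_Suc_Suc mult_Suc mult_Suc_right) (simp del: binomial_Suc_Suc)
  also have "\<dots> = (?c\<^sup>2 * (2*m+1)) * (4 * ((2*m+1) * (2*m+3)))"
    unfolding eq by (simp add: power2_eq_square algebra_simps)
  also have "\<dots> \<le> 16 ^ m * (4 * (4 * (Suc m)\<^sup>2))"
  proof (rule mult_mono[OF Suc.IH])
    have "(2*m+1) * (2*m+3) \<le> 4 * (Suc m)\<^sup>2" by (simp add: power2_eq_square algebra_simps)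
    then show "4 * ((2*m+1) * (2*m+3)) \<le> 4 * (4 * (Suc m)\<^sup>2)" by (rule mult_left_mono) simp
  qed auto
  also have "\<dots> = (Suc m)\<^sup>2 * 16 ^ Suc m" by simp
  finally show ?case by (simp del: power_Suc binomial_Suc_Suc mult_Suc mult_Suc_right)
qed simp

lemma binomial_sq_le: "(n choose k)\<^sup>2 * (n + 1) \<le> 4 ^ n"
proof -
  have "(n choose k)\<^sup>2 * (n + 1) \<le> (n choose (n div 2))\<^sup>2 * (n + 1)"
    by (intro mult_right_mono power_mono binomial_maximum) auto
  also have "\<dots> \<le> 4 ^ n"
  proof (cases "even n")
    case True
    then obtain m where "n = 2 * m" by blast
    then show ?thesis using central_binomial_sq_le[of m] by (simp add: power_mult)
  next
    case False
    then obtain m where n: "n = 2 * m + 1" using oddE by blast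
    \<comment> \<open>The odd case reduces to the even one: by symmetry, twice this middle
      coefficient is the central coefficient of \<open>2 * Suc m\<close>.\<close>
    have "(2*m+1) choose m = (2*m+1) choose Suc m"
      by (subst binomial_symmetric) auto
    then have "2 * (n choose m) = 2 * Suc m choose Suc m" unfolding n by simp
    moreover have "(2 * Suc m choose Suc m)\<^sup>2 * (2 * Suc m + 1) \<le> 16 ^ Suc m"
      by (rule central_binomial_sq_le)
    ultimately have "(2 * (n choose m))\<^sup>2 * (2 * m + 3) \<le> 16 ^ Suc m"
      by (simp add: algebra_simps)
    then have "4 * ((n choose m)\<^sup>2 * (2 * m + 3)) \<le> 4 * (4 * 16 ^ m)"
      by (simp add: power_mult_distrib)
    moreover have "(4::nat) * 16 ^ m = 4 ^ n" by (simp add: n power_mult)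
    ultimately have "(n choose m)\<^sup>2 * (2 * m + 3) \<le> 4 ^ n" by linarith
    moreover have "(n choose m)\<^sup>2 * (n + 1) \<le> (n choose m)\<^sup>2 * (2 * m + 3)"
      by (rule mult_left_mono) (auto simp: n)
    moreover have "n div 2 = m" using n by simp
    ultimately show ?thesis by (metis order_trans)
  qed
  finally show ?thesis .
qed

lemma binomial_le_sqrt: "real (n choose k) \<le> 2 ^ n / sqrt (real n + 1)"
proof -
  have "real ((n choose k)\<^sup>2 * (n + 1)) \<le> real (4 ^ n)"
    using binomial_sq_le by (subst of_nat_le_iff)
  then have "(real (n choose k))\<^sup>2 * (real n + 1) \<le> 4 ^ n"
    by (simp add: algebra_simps)
  moreover have "(4::real) ^ n = (2 ^ n)\<^sup>2"
    by (simp add: power2_eq_square flip: power_mult_distrib)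
  ultimately have "(real (n choose k) * sqrt (real n + 1))\<^sup>2 \<le> (2 ^ n)\<^sup>2"
    by (simp add: power_mult_distrib)
  then have "real (n choose k) * sqrt (real n + 1) \<le> 2 ^ n"
    by (rule power2_le_imp_le) simp
  then show ?thesis by (simp add: field_simps)
qed

text \<open>The one-dimensional Littlewood--Offord bound: taking the symmetric difference with the set of
  minus signs turns a prescribed value into a prescribed size.\<close>

lemma card_signed_sum_le:
  fixes s :: "'a \<Rightarrow> int"
  assumes "finite E" and s: "\<And>x. x \<in> E \<Longrightarrow> s x = 1 \<or> s x = -1"
  shows "real (card {C \<in> Pow E. (\<Sum>x\<in>C. s x) = v}) \<le> 2 ^ card E / sqrt (real (card E) + 1)"
proof -
  define M where "M = {x \<in> E. s x = -1}"
  define f where "f C = (C - M) \<union> (M - C)" for C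
  have ff: "f (f C) = C" for C by (auto simp: f_def)
  have fM: "finite M" using assms by (simp add: M_def)
  have sub: "f ` {C \<in> Pow E. (\<Sum>x\<in>C. s x) = v} \<subseteq> {C. C \<subseteq> E \<and> card C = nat (v + card M)}"
  proof clarsimp
    fix C assume C: "C \<subseteq> E" "v = (\<Sum>x\<in>C. s x)"
    have fC: "finite C" using C assms(1) finite_subset by blast
    have "(\<Sum>x\<in>C. s x) = (\<Sum>x\<in>C - M. s x) + (\<Sum>x\<in>C \<inter> M. s x)"
      by (metis Int_Diff_Un Int_Diff_disjoint add.commute finite_Diff finite_Int fC sum.union_disjoint)
    also have "(\<Sum>x\<in>C - M. s x) = (\<Sum>x\<in>C - M. 1)"
      by (rule sum.cong) (use s C in \<open>auto simp: M_def\<close>)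
    also have "(\<Sum>x\<in>C \<inter> M. s x) = (\<Sum>x\<in>C \<inter> M. -1)"
      by (rule sum.cong) (auto simp: M_def)
    finally have 1: "(\<Sum>x\<in>C. s x) = int (card (C - M)) - int (card (C \<inter> M))" by simp
    have "card (f C) = card (C - M) + card (M - C)"
      unfolding f_def by (rule card_Un_disjoint) (use fC fM in auto)
    moreover have "card M = card (M - C) + card (C \<inter> M)"
      by (metis Int_commute add.commute card_Int_Diff fM)
    ultimately have "int (card (f C)) = (\<Sum>x\<in>C. s x) + card M" using 1 by simp
    moreover have "f C \<subseteq> E" using C by (auto simp: f_def M_def)
    ultimately show "f C \<subseteq> E \<and> card (f C) = nat ((\<Sum>x\<in>C. s x) + int (card M))" by simp
  qed
  have "card {C \<in> Pow E. (\<Sum>x\<in>C. s x) = v} = card (f ` {C \<in> Pow E. (\<Sum>x\<in>C. s x) = v})"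
    by (metis (no_types, lifting) card_image ff inj_on_inverseI)
  also have "\<dots> \<le> card {C. C \<subseteq> E \<and> card C = nat (v + card M)}"
    by (rule card_mono[OF _ sub]) (use assms in auto)
  also have "\<dots> = card E choose nat (v + card M)" by (rule n_subsets[OF assms(1)])
  finally show ?thesis using binomial_le_sqrt[of "card E" "nat (v + card M)"] by linarith
qed

text \<open>Elements of \<open>U - E\<close> do not enter the sum, so each solution inside
  \<open>E\<close> extends in \<open>2 ^ (card U - card E)\<close> ways.\<close>

lemma card_signed_sum_Int_le:
  fixes s :: "'a \<Rightarrow> int"
  assumes "finite U" "E \<subseteq> U" and s: "\<And>x. x \<in> E \<Longrightarrow> s x = 1 \<or> s x = -1"
  shows "real (card {C \<in> Pow U. (\<Sum>x\<in>C \<inter> E. s x) = v}) \<le> 2 ^ card U / sqrt (real (card E) + 1)"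
proof -
  have fE: "finite E" using assms finite_subset by blast
  let ?A = "{C \<in> Pow E. (\<Sum>x\<in>C. s x) = v}"
  have inj: "inj_on (\<lambda>C. (C \<inter> E, C - E)) {C \<in> Pow U. (\<Sum>x\<in>C \<inter> E. s x) = v}"
    by (rule inj_onI) blast
  have "card {C \<in> Pow U. (\<Sum>x\<in>C \<inter> E. s x) = v} \<le> card (?A \<times> Pow (U - E))"
    by (rule card_inj_on_le[OF inj]) (use fE assms in auto)
  also have "\<dots> = card ?A * 2 ^ (card U - card E)"
    using assms fE by (simp add: card_cartesian_product card_Pow card_Diff_subset)
  finally have "real (card {C \<in> Pow U. (\<Sum>x\<in>C \<inter> E. s x) = v}) \<le> real (card ?A) * 2 ^ (card U - card E)"
    by (metis (mono_tags, lifting) of_nat_le_iff of_nat_mult of_nat_numeral of_nat_power)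
  also have "\<dots> \<le> (2 ^ card E / sqrt (real (card E) + 1)) * 2 ^ (card U - card E)"
    by (intro mult_right_mono card_signed_sum_le fE s) auto
  also have "\<dots> = 2 ^ card U / sqrt (real (card E) + 1)"
    using card_mono[OF assms(1,2)] by (simp add: power_add[symmetric])
  finally show ?thesis .
qed

lemma card_le_of_diff_le:
  fixes S :: "nat set" and D :: real
  assumes "finite S" "D \<ge> 0" "\<And>i i'. i \<in> S \<Longrightarrow> i' \<in> S \<Longrightarrow> i < i' \<Longrightarrow> real i' - real i \<le> D"
  shows "real (card S) \<le> D + 1"
proof (cases "S = {}")
  case False
  have "S \<subseteq> {Min S..Max S}" using assms(1) by auto
  then have "card S \<le> Max S + 1 - Min S" by (metis card_atLeastAtMost card_mono finite_atLeastAtMost Suc_eq_plus1)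
  moreover have m: "Min S \<in> S" "Max S \<in> S" "Min S \<le> Max S" using assms(1) False by auto
  moreover have "real (Max S) - real (Min S) \<le> D"
    using assms(2) assms(3)[OF m(1,2)] m(3) by (cases "Min S = Max S") auto
  ultimately show ?thesis by linarith
qed (use assms in simp)

lemma card_affine_window_le:
  fixes a b \<rho> :: real
  assumes "a \<noteq> 0" "\<rho> \<ge> 0" "finite I"
  shows "real (card {i \<in> I. \<bar>real i * a + b\<bar> \<le> \<rho>}) \<le> 2 * \<rho> / \<bar>a\<bar> + 1"
proof (rule card_le_of_diff_le)
  fix i i' assume "i \<in> {i \<in> I. \<bar>real i * a + b\<bar> \<le> \<rho>}" "i' \<in> {i \<in> I. \<bar>real i * a + b\<bar> \<le> \<rho>}"
  then have "\<bar>(real i' - real i) * a\<bar> \<le> 2 * \<rho>" by (auto simp: algebra_simps abs_if split: if_splits)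
  then have "\<bar>real i' - real i\<bar> \<le> 2 * \<rho> / \<bar>a\<bar>"
    using assms by (simp only: abs_mult pos_le_divide_eq zero_less_abs_iff if_True)
      (simp add: pos_le_divide_eq)
  then show "real i' - real i \<le> 2 * \<rho> / \<bar>a\<bar>" by linarith
qed (use assms in auto)

section \<open>Tails and point probabilities of label sums\<close>

text \<open>A label falls below \<open>\<tau> x\<close> with probability
  \<open>\<tau> x / 4N\<close>, so the quotient in \<open>far\<close> is the mean of the sum.
  Hitting \<open>v\<close> then forces a deviation of at least \<open>R\<close> in a known
  direction.\<close>

lemma PiE_tail_sum:
  fixes \<phi> :: "'a \<Rightarrow> int" and \<tau> :: "'a \<Rightarrow> nat"
  assumes fin: "finite U" and N: "N > 0"
    and \<tau>: "\<And>x. x \<in> U \<Longrightarrow> \<tau> x \<le> 4 * N"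
    and \<phi>: "\<And>x. x \<in> U \<Longrightarrow> \<bar>\<phi> x\<bar> \<le> 1"
    and R: "0 \<le> R" "R \<le> 2 * real (card U)"
    and far: "R \<le> \<bar>(\<Sum>x\<in>U. real_of_int (\<phi> x) * real (\<tau> x)) / (4 * real N) - real_of_int v\<bar>"
  shows "real (card {l \<in> U \<rightarrow>\<^sub>E {..<4*N}. (\<Sum>x\<in>U. if l x < \<tau> x then \<phi> x else 0) = v})
          \<le> exp (- (R\<^sup>2 / (4 * card U))) * real (4 * N) ^ card U"
proof -
  define p where "p x = real (\<tau> x) / (4 * real N)" for x
  have p: "0 \<le> p x" "p x \<le> 1" if "x \<in> U" for x using \<tau>[OF that] N by (auto simp: p_def field_simps)
  define \<mu> where "\<mu> = (\<Sum>x\<in>U. real_of_int (\<phi> x) * p x)"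
  define g where "g s x y = s * (real_of_int (\<phi> x) * ((if y < \<tau> x then 1 else 0) - p x))"
    for s :: real and x and y :: nat
  have sum0: "(\<Sum>y<4*N. g s x y) = 0" if "x \<in> U" for s x
  proof -
    have "{..<4*N} \<inter> {y. y < \<tau> x} = {..<\<tau> x}" using \<tau>[OF that] by auto
    then have "(\<Sum>y<4*N. (if y < \<tau> x then 1 else 0) - p x) = 0"
      using N by (simp add: sum_subtractf sum.If_cases p_def)
    then show ?thesis by (simp add: g_def flip: sum_distrib_left)
  qed
  have g1: "\<bar>g s x y\<bar> \<le> 1" if "x \<in> U" "\<bar>s\<bar> = 1" for s x y
  proof -
    have "\<bar>real_of_int (\<phi> x)\<bar> \<le> 1" using \<phi>[OF that(1)] by linarith
    moreover have "\<bar>(if y < \<tau> x then 1 else 0) - p x\<bar> \<le> 1" using p[OF that(1)] by auto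
    ultimately show ?thesis using that(2) by (auto simp: g_def abs_mult intro: mult_le_one)
  qed
  \<comment> \<open>The sign \<open>s\<close> records the side of the mean on which \<open>v\<close>
    lies, so that one upper tail covers both cases.\<close>
  obtain s :: real where s: "\<bar>s\<bar> = 1" "s * (real_of_int v - \<mu>) \<ge> R"
  proof (cases "real_of_int v \<ge> \<mu>")
    case True
    then show ?thesis using far by (intro that[of 1]) (auto simp: \<mu>_def p_def sum_divide_distrib)
  next
    case False
    then show ?thesis using far by (intro that[of "-1"]) (auto simp: \<mu>_def p_def sum_divide_distrib)
  qed
  have "{l \<in> U \<rightarrow>\<^sub>E {..<4*N}. (\<Sum>x\<in>U. if l x < \<tau> x then \<phi> x else 0) = v}
        \<subseteq> {l \<in> U \<rightarrow>\<^sub>E {..<4*N}. R \<le> (\<Sum>x\<in>U. g s x (l x))}"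
  proof clarify
    fix l assume v: "v = (\<Sum>x\<in>U. if l x < \<tau> x then \<phi> x else 0)"
    have "(\<Sum>x\<in>U. g s x (l x)) = s * (\<Sum>x\<in>U. real_of_int (if l x < \<tau> x then \<phi> x else 0) - real_of_int (\<phi> x) * p x)"
      unfolding g_def sum_distrib_left by (intro sum.cong) (auto simp: algebra_simps)
    also have "\<dots> = s * (real_of_int v - \<mu>)"
      by (simp add: sum_subtractf v \<mu>_def)
    finally show "R \<le> (\<Sum>x\<in>U. g s x (l x))" using s by simp
  qed
  then have "card {l \<in> U \<rightarrow>\<^sub>E {..<4*N}. (\<Sum>x\<in>U. if l x < \<tau> x then \<phi> x else 0) = v}
        \<le> card {l \<in> U \<rightarrow>\<^sub>E {..<4*N}. R \<le> (\<Sum>x\<in>U. g s x (l x))}"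
    by (intro card_mono) (auto simp: fin finite_PiE)
  also have "real \<dots> \<le> exp (- (R\<^sup>2 / (4 * card U))) * real (card {..<4*N}) ^ card U"
    by (rule PiE_upper_tail) (use fin g1 s(1) sum0 R in auto)
  finally show ?thesis by simp
qed

text \<open>Conditionally on which vertices have an extreme label, the reflection \<open>y \<mapsto> 4N - 1 - y\<close> of extreme
  labels supplies independent fair coins, to which the Littlewood--Offord bound applies.\<close>

lemma PiE_anticoncentration:
  fixes \<phi> :: "'a \<Rightarrow> int" and \<tau> :: "'a \<Rightarrow> nat"
  assumes fin: "finite U" and N: "N > 0"
    and \<tau>: "\<And>x. x \<in> U \<Longrightarrow> N \<le> \<tau> x \<and> \<tau> x \<le> 3 * N"
    and \<phi>: "\<And>x. x \<in> U \<Longrightarrow> \<bar>\<phi> x\<bar> \<le> 1"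
    and R: "0 \<le> R" "R \<le> real (card {x \<in> U. \<phi> x \<noteq> 0}) / 4"
    and d: "0 < card {x \<in> U. \<phi> x \<noteq> 0}"
  shows "real (card {l \<in> U \<rightarrow>\<^sub>E {..<4*N}. (\<Sum>x\<in>U. if l x < \<tau> x then \<phi> x else 0) = v})
          \<le> (exp (- (R\<^sup>2 / (4 * card U))) + 2 / sqrt (real (card {x \<in> U. \<phi> x \<noteq> 0}))) * real (4 * N) ^ card U"
proof -
  let ?\<Omega> = "U \<rightarrow>\<^sub>E {..<4*N}"
  let ?D = "{x \<in> U. \<phi> x \<noteq> 0}"
  define X where "X l = (\<Sum>x\<in>U. if l x < \<tau> x then \<phi> x else 0)" for l
  \<comment> \<open>Exactly half of the labels are extreme. Since
    \<open>N \<le> \<tau> x \<le> 3N\<close>, a label below \<open>N\<close> always counts and one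
    from \<open>3N\<close> on never does, so reflecting it switches the contribution of
    \<open>x\<close>.\<close>
  define ext where "ext y \<longleftrightarrow> y < N \<or> 3 * N \<le> y" for y
  define E where "E l = {x \<in> ?D. ext (l x)}" for l
  define f where "f C l = (\<lambda>x. if x \<in> C \<and> ext (l x) then 4 * N - 1 - l x else l x)" for C :: "'a set" and l
  define d where "d = real (card ?D)"
  have fin\<Omega>: "finite ?\<Omega>" using fin by (simp add: finite_PiE)
  have card\<Omega>: "card ?\<Omega> = (4 * N) ^ card U" using fin by (simp add: card_PiE)
  have f\<Omega>: "f C l \<in> ?\<Omega>" if "C \<subseteq> U" "l \<in> ?\<Omega>" for C l
    using that N by (auto simp: f_def PiE_iff extensional_def Pi_iff)
  have fE: "f C (f C l) = l" if "C \<subseteq> U" "l \<in> ?\<Omega>" for C l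
  proof
    fix x show "f C (f C l) x = l x"
    proof (cases "x \<in> C \<and> ext (l x)")
      case True
      then have "l x < 4 * N" using that by (auto simp: PiE_iff)
      then show ?thesis using True by (auto simp: f_def ext_def)
    qed (auto simp: f_def)
  qed
  have bij: "bij_betw (f C) ?\<Omega> ?\<Omega>" if "C \<subseteq> U" for C
    by (rule bij_betw_byWitness[where f' = "f C"]) (use f\<Omega> fE that in auto)
  have Xf: "X (f C l) = X l + (\<Sum>x\<in>C \<inter> E l. \<phi> x * (if l x < N then -1 else 1))"
    if C: "C \<subseteq> U" and l: "l \<in> ?\<Omega>" for C l
  proof -
    have "X (f C l) = (\<Sum>x\<in>U. (if l x < \<tau> x then \<phi> x else 0) +
        (if x \<in> C \<inter> E l then \<phi> x * (if l x < N then -1 else 1) else 0))"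
      unfolding X_def
    proof (rule sum.cong[OF refl])
      fix x assume x: "x \<in> U"
      have "l x < 4 * N" using l x by (auto simp: PiE_iff)
      then show "(if f C l x < \<tau> x then \<phi> x else 0) = (if l x < \<tau> x then \<phi> x else 0) +
        (if x \<in> C \<inter> E l then \<phi> x * (if l x < N then -1 else 1) else 0)"
        using \<tau>[OF x] x by (auto simp: f_def E_def ext_def)
    qed
    also have "\<dots> = X l + (\<Sum>x\<in>U. if x \<in> C \<inter> E l then \<phi> x * (if l x < N then -1 else 1) else 0)"
      by (simp add: sum.distrib X_def)
    also have "(\<Sum>x\<in>U. if x \<in> C \<inter> E l then \<phi> x * (if l x < N then -1 else 1) else 0)
        = (\<Sum>x\<in>C \<inter> E l. \<phi> x * (if l x < N then -1 else 1))"
      using fin C by (subst sum.inter_filter[symmetric]) (auto intro!: sum.cong)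
    finally show ?thesis .
  qed
  define S where "S = {l \<in> ?\<Omega>. X l = v}"
  \<comment> \<open>With \<open>l\<close> fixed, the set \<open>C\<close> plays the role of the fair
    coins: reflecting along \<open>C\<close> changes \<open>X l\<close> by a signed sum over
    \<open>C \<inter> E l\<close>.\<close>
  have inner: "real (card {C \<in> Pow U. X (f C l) = v}) \<le> 2 ^ card U / sqrt (real (card (E l)) + 1)"
    if l: "l \<in> ?\<Omega>" for l
  proof -
    have "{C \<in> Pow U. X (f C l) = v}
        = {C \<in> Pow U. (\<Sum>x\<in>C \<inter> E l. \<phi> x * (if l x < N then -1 else 1)) = v - X l}"
      using Xf l by auto
    also have "real (card \<dots>) \<le> 2 ^ card U / sqrt (real (card (E l)) + 1)"
    proof (rule card_signed_sum_Int_le[OF fin])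
      show "E l \<subseteq> U" by (auto simp: E_def)
      fix x assume "x \<in> E l"
      then have "\<phi> x \<noteq> 0" "\<bar>\<phi> x\<bar> \<le> 1" using \<phi> by (auto simp: E_def)
      then show "\<phi> x * (if l x < N then - 1 else 1) = 1 \<or> \<phi> x * (if l x < N then - 1 else 1) = - 1" by auto
    qed
    finally show ?thesis .
  qed
  \<comment> \<open>These labellings have at least \<open>R\<close> fewer extreme labels on
    \<open>?D\<close> than the expected half; the tail bound makes them rare, and outside them at
    least a quarter of \<open>?D\<close> carries extreme labels.\<close>
  let ?T = "{l \<in> ?\<Omega>. R \<le> (\<Sum>x\<in>U. if \<phi> x \<noteq> 0 then 1/2 - (if ext (l x) then 1 else 0) else (0::real))}"
  have T: "real (card ?T) \<le> exp (- (R\<^sup>2 / (4 * card U))) * real (card {..<4*N}) ^ card U"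
  proof (rule PiE_upper_tail)
    fix x
    have "{..<4*N} \<inter> {y. ext y} = {..<N} \<union> {3*N..<4*N}" by (auto simp: ext_def)
    moreover have "card ({..<N} \<union> {3*N..<4*N}) = card {..<N} + card {3*N..<4*N}"
      by (rule card_Un_disjoint) auto
    ultimately have "card ({..<4*N} \<inter> {y. ext y}) = 2 * N" by simp
    then show "(\<Sum>y<4*N. if \<phi> x \<noteq> 0 then 1/2 - (if ext y then 1 else 0) else (0::real)) = 0"
      by (simp add: sum_subtractf sum.If_cases)
    have "card ?D \<le> card U" by (rule card_mono) (use fin in auto)
    then show "R \<le> 2 * real (card U)" using R by linarith
  qed (use fin R in auto)
  have Elarge: "d / 4 \<le> real (card (E l))" if l: "l \<in> ?\<Omega>" "l \<notin> ?T" for l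
  proof -
    have "(\<Sum>x\<in>U. if \<phi> x \<noteq> 0 then 1/2 - (if ext (l x) then 1 else 0) else (0::real))
      = (\<Sum>x\<in>?D. 1/2 - (if ext (l x) then 1 else 0))"
      using fin by (subst sum.inter_filter) auto
    also have "\<dots> = d / 2 - real (card (E l))"
      using fin by (simp add: sum_subtractf sum.If_cases d_def E_def Int_def conj_commute)
    finally have "d / 2 - real (card (E l)) < R" using l by auto
    then show ?thesis using R by (simp add: d_def)
  qed
  have d0: "d > 0" using d by (simp add: d_def)
  \<comment> \<open>Double counting: every \<open>f C\<close> permutes the labellings, so
    \<open>S\<close> is counted once for each \<open>C\<close>; swapping the sums leaves, for each
    labelling, a count over \<open>C\<close>.\<close>
  have "real (card S) * 2 ^ card U = (\<Sum>C\<in>Pow U. real (card S))"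
    using fin by (simp add: card_Pow)
  also have "\<dots> = (\<Sum>C\<in>Pow U. \<Sum>l\<in>?\<Omega>. if X (f C l) = v then 1 else 0)"
  proof (rule sum.cong[OF refl])
    fix C assume "C \<in> Pow U"
    then have "(\<Sum>l\<in>?\<Omega>. if X (f C l) = v then 1 else 0 :: real) = (\<Sum>l\<in>?\<Omega>. if X l = v then 1 else 0)"
      using sum.reindex_bij_betw[OF bij, of C "\<lambda>l. if X l = v then 1 else 0 :: real"] by simp
    then show "real (card S) = (\<Sum>l\<in>?\<Omega>. if X (f C l) = v then 1 else 0)"
      using fin\<Omega> by (simp add: S_def sum.If_cases Int_def)
  qed
  also have "\<dots> = (\<Sum>l\<in>?\<Omega>. \<Sum>C\<in>Pow U. if X (f C l) = v then 1 else 0)"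
    by (rule sum.swap)
  also have "\<dots> = (\<Sum>l\<in>?\<Omega>. real (card {C \<in> Pow U. X (f C l) = v}))"
    using fin by (simp add: sum.If_cases Int_def)
  also have "\<dots> \<le> (\<Sum>l\<in>?\<Omega>. (if l \<in> ?T then 2 ^ card U else 0) + 2 ^ card U * (2 / sqrt d))"
  proof (rule sum_mono)
    fix l assume l: "l \<in> ?\<Omega>"
    show "real (card {C \<in> Pow U. X (f C l) = v}) \<le> (if l \<in> ?T then 2 ^ card U else 0) + 2 ^ card U * (2 / sqrt d)"
    proof (cases "l \<in> ?T")
      case True
      have "2 ^ card U / sqrt (real (card (E l)) + 1) \<le> 2 ^ card U / 1"
        by (rule divide_left_mono) auto
      moreover have "0 \<le> (2::real) ^ card U * (2 / sqrt d)" using d0 by simp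
      ultimately show ?thesis using inner[OF l] True by simp
    next
      case False
      have "sqrt d / 2 = sqrt (d / 4)" by (simp add: real_sqrt_divide)
      also have "\<dots> \<le> sqrt (real (card (E l)) + 1)" using Elarge[OF l False] by simp
      finally have "1 / sqrt (real (card (E l)) + 1) \<le> 1 / (sqrt d / 2)"
        using d0 by (intro divide_left_mono) auto
      then have "2 ^ card U * (1 / sqrt (real (card (E l)) + 1)) \<le> 2 ^ card U * (1 / (sqrt d / 2))"
        by (rule mult_left_mono) auto
      then have "real (card {C \<in> Pow U. X (f C l) = v}) \<le> 2 ^ card U * (2 / sqrt d)"
        using inner[OF l] by simp
      then show ?thesis by (simp only: if_not_P[OF False] add_0)
    qed
  qed
  also have "\<dots> = (\<Sum>l\<in>?\<Omega>. if l \<in> ?T then 2 ^ card U else 0) + real (card ?\<Omega>) * (2 ^ card U * (2 / sqrt d))"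
    by (simp add: sum.distrib)
  also have "(\<Sum>l\<in>?\<Omega>. if l \<in> ?T then 2 ^ card U else 0) = real (card ?T) * 2 ^ card U"
  proof -
    have "?\<Omega> \<inter> ?T = ?T" by auto
    then show ?thesis using sum.inter_restrict[OF fin\<Omega>, of "\<lambda>_. 2 ^ card U :: real" ?T] by simp
  qed
  also have "real (card ?T) * 2 ^ card U + real (card ?\<Omega>) * (2 ^ card U * (2 / sqrt d))
     = (real (card ?T) + real (card ?\<Omega>) * (2 / sqrt d)) * 2 ^ card U" by (simp add: algebra_simps)
  finally have "real (card S) \<le> real (card ?T) + real (card ?\<Omega>) * (2 / sqrt d)"
    by (rule mult_right_le_imp_le) simp
  also have "\<dots> \<le> exp (- (R\<^sup>2 / (4 * card U))) * real (4*N) ^ card U + real (4*N) ^ card U * (2 / sqrt d)"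
    using T by (intro add_mono) (auto simp: card\<Omega>)
  finally show ?thesis by (simp add: S_def X_def d_def algebra_simps)
qed

text \<open>If \<open>|m| \<le> 2R\<close>, the bound exceeds the number \<open>4N^2\<close> of
  pairs. Otherwise, if both drifts are below \<open>|m| / 3\<close>, the quotient is at most
  \<open>|m| / 2\<close> in modulus, as \<open>i, j < 3N\<close>, and misses \<open>m\<close> by
  more than \<open>R\<close>. If one drift is at least \<open>|m| / 3\<close>, each line in its
  direction contains few admissible indices.\<close>

lemma card_drift_le:
  fixes \<Delta>1 \<Delta>2 m R :: real
  assumes N: "N > 0" and m: "m \<noteq> 0" and R: "R \<ge> 0"
  shows "real (card {(i, j) \<in> {N..<3*N} \<times> {N..<3*N}. \<bar>(real i * \<Delta>1 + real j * \<Delta>2) / (4 * real N) - m\<bar> \<le> R})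
          \<le> 48 * (real N)\<^sup>2 * R / \<bar>m\<bar> + 2 * real N"
    (is "real (card ?S) \<le> _")
proof -
  let ?I = "{N..<3*N}"
  have fS: "finite ?S" by (rule finite_subset[of _ "?I \<times> ?I"]) auto
  have line: "real (card {i \<in> ?I. \<bar>(real i * a + c) / (4 * real N) - m\<bar> \<le> R}) \<le> 24 * real N * R / \<bar>m\<bar> + 1"
    if a: "\<bar>a\<bar> \<ge> \<bar>m\<bar> / 3" for a c
  proof -
    have a0: "a \<noteq> 0" using a m by auto
    have "\<bar>real i * a + (c - 4 * real N * m)\<bar> \<le> 4 * real N * R \<longleftrightarrow> \<bar>(real i * a + c) / (4 * real N) - m\<bar> \<le> R" for i
    proof -
      have "real i * a + (c - 4 * real N * m) = (4 * real N) * ((real i * a + c) / (4 * real N) - m)"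
        using N by (simp add: field_simps)
      then show ?thesis using N by (simp add: abs_mult)
    qed
    then have "real (card {i \<in> ?I. \<bar>(real i * a + c) / (4 * real N) - m\<bar> \<le> R}) \<le> 2 * (4 * real N * R) / \<bar>a\<bar> + 1"
      using card_affine_window_le[OF a0, of "4 * real N * R" ?I "c - 4 * real N * m"] R by simp
    also have "2 * (4 * real N * R) / \<bar>a\<bar> \<le> 2 * (4 * real N * R) / (\<bar>m\<bar> / 3)"
      using a a0 m R N by (intro divide_left_mono mult_pos_pos) auto
    finally show ?thesis by simp
  qed
  consider "\<bar>m\<bar> \<le> 2 * R" | "\<bar>m\<bar> > 2 * R" "\<bar>\<Delta>1\<bar> \<ge> \<bar>m\<bar> / 3" | "\<bar>m\<bar> > 2 * R" "\<bar>\<Delta>2\<bar> \<ge> \<bar>m\<bar> / 3"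
    | "\<bar>m\<bar> > 2 * R" "\<bar>\<Delta>1\<bar> < \<bar>m\<bar> / 3" "\<bar>\<Delta>2\<bar> < \<bar>m\<bar> / 3" by linarith
  then show ?thesis
  proof cases
    case 1
    have "card ?S \<le> card (?I \<times> ?I)" by (rule card_mono) auto
    then have "real (card ?S) \<le> real (card (?I \<times> ?I))" by (rule of_nat_mono)
    then have "real (card ?S) \<le> 4 * (real N)\<^sup>2 * 1" by (simp add: card_cartesian_product power2_eq_square)
    also have "\<dots> \<le> 4 * (real N)\<^sup>2 * (12 * (R / \<bar>m\<bar>))"
      using 1 m R by (intro mult_left_mono) (auto simp: field_simps)
    finally show ?thesis by simp
  next
    case 2
    have "?S = (\<lambda>(j, i). (i, j)) ` (SIGMA j:?I. {i \<in> ?I. \<bar>(real i * \<Delta>1 + real j * \<Delta>2) / (4 * real N) - m\<bar> \<le> R})"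
      by force
    then have "card ?S \<le> card (SIGMA j:?I. {i \<in> ?I. \<bar>(real i * \<Delta>1 + real j * \<Delta>2) / (4 * real N) - m\<bar> \<le> R})"
      by (simp only:) (rule card_image_le, auto)
    also have "\<dots> = (\<Sum>j\<in>?I. card {i \<in> ?I. \<bar>(real i * \<Delta>1 + real j * \<Delta>2) / (4 * real N) - m\<bar> \<le> R})"
      by (rule card_SigmaI) auto
    also have "real \<dots> \<le> (\<Sum>j\<in>?I. 24 * real N * R / \<bar>m\<bar> + 1)"
      unfolding of_nat_sum by (intro sum_mono line 2)
    finally show ?thesis by (simp add: algebra_simps power2_eq_square)
  next
    case 3
    have "?S = (SIGMA i:?I. {j \<in> ?I. \<bar>(real j * \<Delta>2 + real i * \<Delta>1) / (4 * real N) - m\<bar> \<le> R})"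
      by (force simp: add.commute)
    then have "card ?S = (\<Sum>i\<in>?I. card {j \<in> ?I. \<bar>(real j * \<Delta>2 + real i * \<Delta>1) / (4 * real N) - m\<bar> \<le> R})"
      by (simp add: card_SigmaI)
    also have "real \<dots> \<le> (\<Sum>j\<in>?I. 24 * real N * R / \<bar>m\<bar> + 1)"
      unfolding of_nat_sum by (intro sum_mono line 3)
    finally show ?thesis by (simp add: algebra_simps power2_eq_square)
  next
    case 4
    have "?S = {}"
    proof (rule equals0I, clarsimp)
      fix i j assume ij: "i < 3 * N" "j < 3 * N" "N \<le> i" "N \<le> j"
        and le: "\<bar>(real i * \<Delta>1 + real j * \<Delta>2) / (4 * real N) - m\<bar> \<le> R"
      have "\<bar>real i * \<Delta>1\<bar> \<le> (3 * real N) * (\<bar>m\<bar> / 3)" "\<bar>real j * \<Delta>2\<bar> \<le> (3 * real N) * (\<bar>m\<bar> / 3)"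
        using ij 4 unfolding abs_mult by (intro mult_mono; simp)+
      then have "\<bar>real i * \<Delta>1 + real j * \<Delta>2\<bar> \<le> 2 * real N * \<bar>m\<bar>" by linarith
      then have "\<bar>(real i * \<Delta>1 + real j * \<Delta>2) / (4 * real N)\<bar> \<le> \<bar>m\<bar> / 2"
        using N by (simp add: field_simps)
      then show False using le 4 by linarith
    qed
    then have "real (card ?S) = 0" by (simp only: card.empty of_nat_0)
    moreover have "0 \<le> 48 * (real N)\<^sup>2 * R / \<bar>m\<bar> + 2 * real N" using R by simp
    ultimately show ?thesis by linarith
  qed
qed

subsection \<open>Lopsided homogeneous pairs in Ramsey graphs\<close>

text \<open>The Erdos--Szekeres recursion on the neighbours and non-neighbours of a vertex, with the
  binomial threshold of Pascal's rule. It is then weakened to \<open>(k + l) ^ k\<close>, which is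
  polynomial in \<open>l\<close> for fixed \<open>k\<close>.\<close>

lemma clique_or_indep_of_card:
  assumes "finite S" "(k + l) ^ k \<le> card S"
  shows "\<exists>Q\<subseteq>S. (card Q = k \<and> clique Q E) \<or> (card Q = l \<and> indep Q E)"
proof -
  have "\<exists>Q\<subseteq>S. (card Q = k \<and> clique Q E) \<or> (card Q = l \<and> indep Q E)"
    if "finite S" "(k + l) choose k \<le> card S" for k l S
    using that
  proof (induction "k + l" arbitrary: k l S)
    case 0
    then show ?case by (intro exI[of _ "{}"]) auto
  next
    case (Suc n)
    show ?case
    proof (cases "k = 0 \<or> l = 0")
      case True
      then show ?thesis by (intro exI[of _ "{}"]) auto
    next
      case False
      then obtain k' l' where kl: "k = Suc k'" "l = Suc l'" by (meson not0_implies_Suc)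
      have "(k + l) choose k = (k' + l choose k') + (k + l' choose k)"
        using kl by simp
      then have cS: "(k' + l choose k') + (k + l' choose k) \<le> card S" using Suc.prems by simp
      have "card S > 0" using cS kl by (metis add_is_0 binomial_eq_0_iff gr0I le_add1 le_zero_eq not_less)
      then obtain x where x: "x \<in> S" by fastforce
      define A where "A = {y \<in> S - {x}. {x, y} \<in> E}"
      define B where "B = {y \<in> S - {x}. {x, y} \<notin> E}"
      have fin: "finite A" "finite B" using Suc.prems by (auto simp: A_def B_def)
      have "card (S - {x}) = card A + card B"
        using fin by (subst card_Un_disjoint[symmetric]) (auto simp: A_def B_def intro!: arg_cong[of _ _ card])
      then have "card S = Suc (card A + card B)"
        using x Suc.prems(1) by (metis card.remove)
      then consider "k' + l choose k' \<le> card A" | "k + l' choose k \<le> card B" using cS by linarith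
      then show ?thesis
      proof cases
        case 1
        have "n = k' + l" using Suc.hyps(2) kl by simp
        from Suc.hyps(1)[OF this fin(1) 1] obtain Q where Q: "Q \<subseteq> A"
          "(card Q = k' \<and> clique Q E) \<or> (card Q = l \<and> indep Q E)" by blast
        show ?thesis
        proof (cases "card Q = k' \<and> clique Q E")
          case True
          have "card (insert x Q) = k" using True Q fin kl
            by (subst card_insert_disjoint) (auto simp: A_def dest: finite_subset)
          moreover have "clique (insert x Q) E"
            using True Q by (fastforce simp: clique_def A_def insert_commute)
          ultimately show ?thesis using Q x by (intro exI[of _ "insert x Q"]) (auto simp: A_def)
        next
          case False
          then show ?thesis using Q by (intro exI[of _ Q]) (auto simp: A_def)
        qed
      next
        case 2
        have "n = k + l'" using Suc.hyps(2) kl by simp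
        from Suc.hyps(1)[OF this fin(2) 2] obtain Q where Q: "Q \<subseteq> B"
          "(card Q = k \<and> clique Q E) \<or> (card Q = l' \<and> indep Q E)" by blast
        show ?thesis
        proof (cases "card Q = l' \<and> indep Q E")
          case True
          have "card (insert x Q) = l" using True Q fin kl
            by (subst card_insert_disjoint) (auto simp: B_def dest: finite_subset)
          moreover have "indep (insert x Q) E"
            using True Q by (fastforce simp: indep_def B_def insert_commute)
          ultimately show ?thesis using Q x by (intro exI[of _ "insert x Q"]) (auto simp: B_def)
        next
          case False
          then show ?thesis using Q by (intro exI[of _ Q]) (auto simp: B_def)
        qed
      qed
    qed
  qed
  moreover have "(k + l) choose k \<le> (k + l) ^ k"
    by (rule binomial_le_pow) simp
  ultimately show ?thesis using assms by (meson order_trans)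
qed

text \<open>Homogeneous sets stay below \<open>l\<close>, so only the alternative of size
  \<open>k\<close> can occur. Using both \<open>E\<close> and \<open>- E\<close>, which exchanges
  cliques and independent sets, yields both kinds.\<close>

lemma clique_or_indep_disjoint:
  assumes "finite S" "(k + l) ^ k \<le> card S" "\<And>Q. Q \<subseteq> S \<Longrightarrow> clique Q E \<or> indep Q E \<Longrightarrow> card Q < l"
  shows "(\<exists>Q\<subseteq>S. card Q = k \<and> clique Q E) \<and> (\<exists>Q\<subseteq>S. card Q = k \<and> indep Q E)"
proof
  show "\<exists>Q\<subseteq>S. card Q = k \<and> clique Q E"
    using clique_or_indep_of_card[OF assms(1,2), of E] assms(3) by blast
  have "\<exists>Q\<subseteq>S. (card Q = k \<and> clique Q (- E)) \<or> (card Q = l \<and> indep Q (- E))"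
    by (rule clique_or_indep_of_card[OF assms(1,2)])
  then obtain Q where Q: "Q \<subseteq> S" "(card Q = k \<and> clique Q (- E)) \<or> (card Q = l \<and> indep Q (- E))" by blast
  have "clique Q (- E) = indep Q E" "indep Q (- E) = clique Q E"
    by (auto simp: clique_def indep_def)
  then show "\<exists>Q\<subseteq>S. card Q = k \<and> indep Q E"
    using Q assms(3)[OF Q(1)] by auto
qed

section \<open>Iterating lopsided pairs\<close>

text \<open>Only \<open>A\<close> must be a fixed fraction of \<open>W\<close>, so passing from
  \<open>W\<close> to \<open>A\<close> costs a factor \<open>K\<close>; the set \<open>S\<close>
  just has to be large enough to contain homogeneous sets of constant size.\<close>

definition lopsided :: "'a set set \<Rightarrow> real \<Rightarrow> real \<Rightarrow> 'a set \<Rightarrow> bool" where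
  "lopsided E a K W \<longleftrightarrow> (\<exists>S A. S \<subseteq> W \<and> A \<subseteq> W \<and> S \<inter> A = {} \<and> a \<le> real (card S) \<and> real (card W) \<le> K * real (card A) \<and>
     ((\<forall>x\<in>S. \<forall>y\<in>A. {x, y} \<in> E) \<or> (\<forall>x\<in>S. \<forall>y\<in>A. {x, y} \<notin> E)))"

text \<open>Each round takes from \<open>S\<close> a clique and an independent set of size
  \<open>k\<close>. A complete pair lets the clique join the one found inside \<open>A\<close>, an
  empty pair does the same for the independent set; \<open>p\<close> and \<open>q\<close> count the
  two kinds of rounds.\<close>

lemma lopsided_iterate:
  assumes "finite W" "K \<ge> 1" "b > 0"
    and split: "\<And>S. S \<subseteq> W \<Longrightarrow> a \<le> real (card S) \<Longrightarrow>
        (\<exists>Q\<subseteq>S. card Q = k \<and> clique Q E) \<and> (\<exists>Q\<subseteq>S. card Q = k \<and> indep Q E)"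
    and lop: "\<And>W'. W' \<subseteq> W \<Longrightarrow> b \<le> real (card W') \<Longrightarrow> lopsided E a K W'"
    and "b * K ^ T \<le> real (card W)"
  shows "\<exists>p q. p + q = T \<and> (\<exists>Q\<subseteq>W. card Q = p * k \<and> clique Q E) \<and> (\<exists>Q\<subseteq>W. card Q = q * k \<and> indep Q E)"
  using assms
proof (induction T arbitrary: W)
  case 0
  then show ?case by (intro exI[of _ 0]) (auto intro: exI[of _ "{}"])
next
  case (Suc T)
  have K1: "1 \<le> K ^ T" "1 \<le> K ^ Suc T" using Suc.prems(2) by (simp_all add: one_le_power del: power_Suc)
  have "b * 1 \<le> b * K ^ Suc T" using K1 Suc.prems(3) by (intro mult_left_mono) auto
  then have "b \<le> real (card W)" using Suc.prems(6) by linarith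
  then have "lopsided E a K W" by (intro Suc.prems(5)) auto
  then obtain S A where SA: "S \<subseteq> W" "A \<subseteq> W" "S \<inter> A = {}" "a \<le> real (card S)" "real (card W) \<le> K * real (card A)"
    "(\<forall>x\<in>S. \<forall>y\<in>A. {x, y} \<in> E) \<or> (\<forall>x\<in>S. \<forall>y\<in>A. {x, y} \<notin> E)" by (auto simp: lopsided_def)
  have fin: "finite S" "finite A" using SA Suc.prems(1) by (auto intro: finite_subset)
  have "K * (b * K ^ T) \<le> K * real (card A)" using SA Suc.prems(6) by (simp add: mult_ac)
  then have "b * K ^ T \<le> real (card A)" using Suc.prems(2) by simp
  have "\<exists>p q. p + q = T \<and> (\<exists>Q\<subseteq>A. card Q = p * k \<and> clique Q E) \<and> (\<exists>Q\<subseteq>A. card Q = q * k \<and> indep Q E)"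
  proof (rule Suc.IH[OF fin(2) Suc.prems(2,3)])
    show "b * K ^ T \<le> real (card A)" by fact
    show "lopsided E a K W'" if "W' \<subseteq> A" "b \<le> real (card W')" for W'
      using that SA(2) by (intro Suc.prems(5)) auto
    show "(\<exists>Q\<subseteq>S. card Q = k \<and> clique Q E) \<and> (\<exists>Q\<subseteq>S. card Q = k \<and> indep Q E)"
      if "S \<subseteq> A" "a \<le> real (card S)" for S
      using that SA(2) by (intro Suc.prems(4)) auto
  qed
  then obtain p q where pq: "p + q = T"
      "\<exists>Q\<subseteq>A. card Q = p * k \<and> clique Q E" "\<exists>Q\<subseteq>A. card Q = q * k \<and> indep Q E" by blast
  obtain Q1 where Q1: "Q1 \<subseteq> A" "card Q1 = p * k" "clique Q1 E" using pq by blast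
  obtain Q2 where Q2: "Q2 \<subseteq> A" "card Q2 = q * k" "indep Q2 E" using pq by blast
  have "\<exists>Q\<subseteq>S. card Q = k \<and> clique Q E" "\<exists>Q\<subseteq>S. card Q = k \<and> indep Q E"
    using Suc.prems(4)[OF SA(1,4)] by auto
  then obtain Q3 Q4 where Q3: "Q3 \<subseteq> S" "card Q3 = k" "clique Q3 E"
    and Q4: "Q4 \<subseteq> S" "card Q4 = k" "indep Q4 E" by metis
  have finQ: "finite Q1" "finite Q2" "finite Q3" "finite Q4"
    using Q1 Q2 Q3 Q4 fin by (auto intro: finite_subset)
  from SA(6) show ?case
  proof
    assume c: "\<forall>x\<in>S. \<forall>y\<in>A. {x, y} \<in> E"
    have "card (Q3 \<union> Q1) = Suc p * k"
      using Q1 Q3 SA(3) finQ by (subst card_Un_disjoint) auto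
    moreover have "clique (Q3 \<union> Q1) E" by (rule clique_Un) (use Q1 Q3 c in auto)
    moreover have "Q3 \<union> Q1 \<subseteq> W" "Q2 \<subseteq> W" using Q1 Q2 Q3 SA by auto
    moreover have "Suc p + q = Suc T" using pq(1) by simp
    ultimately show ?thesis using Q2 by blast
  next
    assume c: "\<forall>x\<in>S. \<forall>y\<in>A. {x, y} \<notin> E"
    have "card (Q4 \<union> Q2) = Suc q * k"
      using Q2 Q4 SA(3) finQ by (subst card_Un_disjoint) auto
    moreover have "indep (Q4 \<union> Q2) E"
    proof -
      have "{x, y} \<notin> E \<and> {y, x} \<notin> E" if "x \<in> Q4" "y \<in> Q2" for x y
        using c that Q2(1) Q4(1) by (metis insert_commute subsetD)
      then show ?thesis using Q2(3) Q4(3) unfolding indep_def by blast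
    qed
    moreover have "Q4 \<union> Q2 \<subseteq> W" "Q1 \<subseteq> W" using Q1 Q2 Q4 SA by auto
    moreover have "p + Suc q = Suc T" using pq(1) by simp
    ultimately show ?thesis using Q1 by blast
  qed
qed

text \<open>Iterating a lopsided homogeneous pair about \<open>log n\<close> times would produce a homogeneous set
  of size \<open>k\<close> times that number, where the constant \<open>k\<close> can be taken arbitrarily large.\<close>

lemma ramsey_not_lopsided:
  fixes C \<eta> K :: real
  assumes "C > 0" "\<eta> > 0" "K > 1"
  shows "\<forall>\<^sub>F n in sequentially. \<forall>G :: 'a ugraph. simple_graph G \<and> card (verts G) = n \<and> ramsey_graph C G \<longrightarrow>
     (\<exists>W\<subseteq>verts G. real n powr (1 - \<eta>) \<le> real (card W) \<and> \<not> lopsided (edges G) (real n powr \<eta>) K W)"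
proof -
  \<comment> \<open>With at least \<open>\<eta> * log 2 n / (2 * log 2 K)\<close> rounds, this
    \<open>k\<close> yields a total of \<open>4 C log 2 n\<close> vertices in one clique and one
    independent set, twice what the Ramsey property allows.\<close>
  define k where "k = nat \<lceil>8 * C * log 2 K / \<eta>\<rceil>"
  have k: "8 * C * log 2 K / \<eta> \<le> real k" unfolding k_def by linarith
  have lK: "log 2 K > 0" using assms by simp
  have ev1: "\<forall>\<^sub>F n in sequentially. (real k + (C * log 2 (real n) + 2)) powr real k \<le> real n powr \<eta>"
    using assms by real_asymp
  have ev2: "\<forall>\<^sub>F n in sequentially. 4 * log 2 K / \<eta> \<le> log 2 (real n)"
    by real_asymp
  have ev3: "\<forall>\<^sub>F n::nat in sequentially. n \<ge> 2" by (rule eventually_ge_at_top)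
  show ?thesis
    using ev1 ev2 ev3
  proof eventually_elim
    case (elim n)
    show ?case
    proof (intro allI impI, rule ccontr)
      fix G :: "'a ugraph"
      assume G: "simple_graph G \<and> card (verts G) = n \<and> ramsey_graph C G"
      assume not: "\<not> (\<exists>W\<subseteq>verts G. real n powr (1 - \<eta>) \<le> real (card W) \<and> \<not> lopsided (edges G) (real n powr \<eta>) K W)"
      define L where "L = log 2 (real n)"
      have L: "L \<ge> 1" using elim(3) by (simp add: L_def)
      have fV: "finite (verts G)" using G by (simp add: simple_graph_def)
      \<comment> \<open>As many rounds as keep the loss \<open>K ^ T\<close> at most
        \<open>n^\<eta>\<close>, so that sets of size \<open>n^(1 - \<eta>)\<close> remain to the
        end.\<close>
      define T where "T = nat \<lfloor>\<eta> * L / log 2 K\<rfloor>"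
      have T: "real T \<le> \<eta> * L / log 2 K" "\<eta> * L / log 2 K - 1 < real T"
        using assms L lK by (auto simp: T_def)
      have hom: "real (card Q) \<le> C * L" if "Q \<subseteq> verts G" "clique Q (edges G) \<or> indep Q (edges G)" for Q
        using G that by (auto simp: ramsey_graph_def homogeneous_def L_def)
      have "real n powr (1 - \<eta>) * K ^ T \<le> real n"
      proof -
        have "K ^ T = 2 powr (log 2 K * real T)"
          using assms by (simp add: powr_powr[symmetric] powr_realpow)
        also have "\<dots> \<le> 2 powr (\<eta> * L)"
          using T(1) lK by (intro powr_mono) (auto simp: field_simps)
        also have "\<dots> = (2 powr L) powr \<eta>" by (simp add: powr_powr mult.commute)
        also have "\<dots> = real n powr \<eta>" using elim(3) by (simp add: L_def)
        finally have "real n powr (1 - \<eta>) * K ^ T \<le> real n powr (1 - \<eta>) * real n powr \<eta>"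
          by (intro mult_left_mono) auto
        then show ?thesis using elim(3) by (simp flip: powr_add)
      qed
      moreover have "(\<exists>Q\<subseteq>S. card Q = k \<and> clique Q (edges G)) \<and> (\<exists>Q\<subseteq>S. card Q = k \<and> indep Q (edges G))"
        if S: "S \<subseteq> verts G" "real n powr \<eta> \<le> real (card S)" for S
      proof (rule clique_or_indep_disjoint)
        \<comment> \<open>No homogeneous set reaches size \<open>l\<close>, and for constant
          \<open>k\<close> the threshold \<open>(k + l) ^ k\<close> is polylogarithmic in
          \<open>n\<close>, hence below \<open>n^\<eta>\<close>.\<close>
        define l where "l = nat \<lfloor>C * L\<rfloor> + 1"
        have l: "C * L < real l" "real l \<le> C * L + 2" using assms L by (auto simp: l_def) linarith+
        have "real ((k + l) ^ k) = (real k + real l) powr real k"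
          by (subst powr_realpow) (auto simp: l_def add_ac)
        also have "\<dots> \<le> (real k + (C * L + 2)) powr real k"
          using l by (intro powr_mono2) auto
        also have "\<dots> \<le> real (card S)" using elim(1) S by (simp add: L_def)
        finally show "(k + l) ^ k \<le> card S" by (subst (asm) of_nat_le_iff)
        show "finite S" using S fV by (auto intro: finite_subset)
        fix Q assume "Q \<subseteq> S" "clique Q (edges G) \<or> indep Q (edges G)"
        then have "real (card Q) \<le> C * L" using S by (intro hom) auto
        then show "card Q < l" using l by linarith
      qed
      ultimately obtain p q where pq: "p + q = T"
         "\<exists>Q\<subseteq>verts G. card Q = p * k \<and> clique Q (edges G)"
         "\<exists>Q\<subseteq>verts G. card Q = q * k \<and> indep Q (edges G)"
        using lopsided_iterate[OF fV, of K "real n powr (1 - \<eta>)" "real n powr \<eta>" k "edges G" T]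
          assms G elim(3) not by auto
      have "real (p * k) \<le> C * L" "real (q * k) \<le> C * L" using pq hom by metis+
      then have "real T * real k \<le> 2 * C * L" by (simp add: pq(1)[symmetric] algebra_simps)
      moreover have "\<eta> * L / log 2 K / 2 \<le> real T"
      proof -
        have "4 \<le> \<eta> * L / log 2 K" using elim(2) assms lK by (simp add: L_def field_simps)
        moreover have "z / 2 \<le> t" if "4 \<le> z" "z - 1 < t" for z t :: real using that by linarith
        ultimately show ?thesis using T(2) by blast
      qed
      then have "(\<eta> * L / log 2 K / 2) * (8 * C * log 2 K / \<eta>) \<le> real T * real k"
        using k assms L lK by (intro mult_mono) auto
      moreover have "(a * L / b / 2) * (8 * C * b / a) = 4 * C * L" if "a > 0" "b > 0" for a b :: real
        using that by (simp add: field_simps)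
      then have "(\<eta> * L / log 2 K / 2) * (8 * C * log 2 K / \<eta>) = 4 * C * L"
        using assms(2) lK by blast
      moreover have "0 < C * L" using assms L by simp
      ultimately show False by linarith
    qed
  qed
qed

subsection \<open>Values along two chains\<close>

definition val :: "'a set set \<Rightarrow> ('a \<Rightarrow> nat) \<Rightarrow> 'a set \<Rightarrow> nat" where
  "val E \<omega> X = card {e \<in> E. e \<subseteq> X} + sum \<omega> X"

definition deg :: "'a set set \<Rightarrow> 'a set \<Rightarrow> 'a \<Rightarrow> nat" where
  "deg E X y = card {x \<in> X. {x, y} \<in> E}"

lemma val_in_Psi: "X \<subseteq> verts G \<Longrightarrow> (card X, val (edges G) \<omega> X) \<in> Psi G \<omega>"
  unfolding Psi_def induced_subgraph_def val_def
  by (rule CollectI, rule exI[of _ "(X, {e \<in> edges G. e \<subseteq> X})"]) auto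

lemma deg_le: "finite X \<Longrightarrow> deg E X y \<le> card X"
  unfolding deg_def by (rule card_mono) auto

lemma card_edges_insert:
  assumes E: "\<And>e. e \<in> E \<Longrightarrow> card e = 2" and "finite X" "y \<notin> X"
  shows "card {e \<in> E. e \<subseteq> insert y X} = card {e \<in> E. e \<subseteq> X} + deg E X y"
proof -
  let ?N = "{x \<in> X. {x, y} \<in> E}"
  have "{e \<in> E. e \<subseteq> insert y X} = {e \<in> E. e \<subseteq> X} \<union> (\<lambda>x. {x, y}) ` ?N"
  proof (intro equalityI subsetI)
    fix e assume e: "e \<in> {e \<in> E. e \<subseteq> insert y X}"
    show "e \<in> {e \<in> E. e \<subseteq> X} \<union> (\<lambda>x. {x, y}) ` ?N"
    proof (cases "y \<in> e")
      case True
      obtain a b where ab: "e = {a, b}" "a \<noteq> b" using E[of e] e unfolding card_2_iff by blast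
      then obtain x where "e = {x, y}" "x \<noteq> y" using True by blast
      then show ?thesis using e by auto
    qed (use e in auto)
  qed auto
  moreover have "card ({e \<in> E. e \<subseteq> X} \<union> (\<lambda>x. {x, y}) ` ?N)
      = card {e \<in> E. e \<subseteq> X} + card ((\<lambda>x. {x, y}) ` ?N)"
    by (rule card_Un_disjoint) (use assms in \<open>auto intro: finite_subset[of _ "Pow X"]\<close>)
  moreover have "card ((\<lambda>x. {x, y}) ` ?N) = card ?N"
    by (rule card_image) (auto simp: inj_on_def doubleton_eq_iff)
  ultimately show ?thesis by (simp add: deg_def)
qed

lemma val_insert:
  assumes "\<And>e. e \<in> E \<Longrightarrow> card e = 2" "finite X" "y \<notin> X"
  shows "val E \<omega> (insert y X) = val E \<omega> X + (deg E X y + \<omega> y)"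
  using assms card_edges_insert[OF assms] by (simp add: val_def)

lemma card_edges_mono: "finite Z \<Longrightarrow> X \<subseteq> Z \<Longrightarrow> card {e \<in> E. e \<subseteq> X} \<le> card {e \<in> E. e \<subseteq> Z}"
  by (rule card_mono) (auto intro: finite_subset[of _ "Pow Z"])

lemma card_edges_Un_le:
  assumes E: "\<And>e. e \<in> E \<Longrightarrow> card e = 2" and "finite X" "finite D" "X \<inter> D = {}" "card X + card D \<le> k"
  shows "card {e \<in> E. e \<subseteq> X \<union> D} \<le> card {e \<in> E. e \<subseteq> X} + card D * k"
  using assms(3-)
proof (induction D rule: finite_induct)
  case (insert y D)
  have "card {e \<in> E. e \<subseteq> X \<union> insert y D} = card {e \<in> E. e \<subseteq> X \<union> D} + deg E (X \<union> D) y"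
    using card_edges_insert[of E "X \<union> D" y, OF E] insert assms(2) by simp
  moreover have "deg E (X \<union> D) y \<le> k"
    using deg_le[of "X \<union> D" E y] insert assms(2) by (simp add: card_Un_disjoint)
  moreover have "card {e \<in> E. e \<subseteq> X \<union> D} \<le> card {e \<in> E. e \<subseteq> X} + card D * k"
    using insert by simp
  ultimately show ?case using insert by simp
qed simp

text \<open>Passing from \<open>A \<union> B\<close> to \<open>A' \<union> B'\<close> trades heavy
  vertices for equally many light ones. Each trade lowers the weight by at least \<open>gap\<close>
  and gains at most \<open>k\<close> edges.\<close>

lemma val_exchange_le:
  assumes E: "\<And>e. e \<in> E \<Longrightarrow> card e = 2"
    and fin: "finite A'" "finite B" and sub: "A \<subseteq> A'" "B' \<subseteq> B" and dis: "A' \<inter> B = {}"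
    and card: "card A + card B = card A' + card B'" and k: "card A' + card B' \<le> k"
    and low: "\<And>x. x \<in> A' \<Longrightarrow> \<omega> x \<le> \<alpha>" and high: "\<And>x. x \<in> B \<Longrightarrow> \<alpha> + gap \<le> \<omega> x"
  shows "val E \<omega> (A' \<union> B') + (card A' - card A) * gap \<le> val E \<omega> (A \<union> B) + (card A' - card A) * k"
proof -
  define g where "g = card A' - card A"
  have fin': "finite A" "finite B'" using fin sub finite_subset by auto
  have gA: "card (A' - A) = g" using sub fin' by (simp add: card_Diff_subset g_def)
  have gB: "card (B - B') = g"
    using sub fin' fin card card_mono[OF fin(1) sub(1)] by (simp add: card_Diff_subset g_def)
  \<comment> \<open>The comparison goes through \<open>A \<union> B'\<close>: deleting
    \<open>B - B'\<close> creates no edges, and each vertex of \<open>A' - A\<close> brings at most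
    \<open>k\<close>.\<close>
  have "card {e \<in> E. e \<subseteq> A' \<union> B'} = card {e \<in> E. e \<subseteq> (A \<union> B') \<union> (A' - A)}"
    using sub by (intro arg_cong[of _ _ card]) blast
  also have "\<dots> \<le> card {e \<in> E. e \<subseteq> A \<union> B'} + card (A' - A) * k"
  proof (rule card_edges_Un_le[OF E])
    have "card (A \<union> B') + card (A' - A) = card ((A \<union> B') \<union> (A' - A))"
      using sub dis fin fin' by (subst card_Un_disjoint) auto
    also have "\<dots> \<le> card (A' \<union> B')"
      using sub fin fin' by (intro card_mono) auto
    also have "\<dots> \<le> k" using card_Un_le[of A' B'] k by linarith
    finally show "card (A \<union> B') + card (A' - A) \<le> k" .
  qed (use fin fin' sub dis in auto)
  finally have e1: "card {e \<in> E. e \<subseteq> A' \<union> B'} \<le> card {e \<in> E. e \<subseteq> A \<union> B'} + g * k" by (simp add: gA)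
  have e2: "card {e \<in> E. e \<subseteq> A \<union> B'} \<le> card {e \<in> E. e \<subseteq> A \<union> B}"
    using sub fin fin' by (intro card_edges_mono) auto
  have "sum \<omega> (A' \<union> B') = sum \<omega> A' + sum \<omega> B'"
    using fin fin' dis sub by (intro sum.union_disjoint) auto
  moreover have "sum \<omega> (A \<union> B) = sum \<omega> A + sum \<omega> B"
    using fin fin' dis sub by (intro sum.union_disjoint) auto
  moreover have "sum \<omega> A' = sum \<omega> A + sum \<omega> (A' - A)"
    using fin(1) sub(1) by (metis add.commute sum.subset_diff)
  moreover have "sum \<omega> B = sum \<omega> B' + sum \<omega> (B - B')"
    using fin(2) sub(2) by (metis add.commute sum.subset_diff)
  moreover have "sum \<omega> (A' - A) \<le> g * \<alpha>"
    using sum_bounded_above[of "A' - A" \<omega> \<alpha>] low gA by auto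
  moreover have "g * (\<alpha> + gap) \<le> sum \<omega> (B - B')"
    using sum_bounded_below[of "B - B'" "\<alpha> + gap" \<omega>] high gB by auto
  ultimately have "sum \<omega> (A' \<union> B') + g * gap \<le> sum \<omega> (A \<union> B)"
    by (simp add: algebra_simps)
  then show ?thesis using e1 e2 unfolding val_def g_def[symmetric] by linarith
qed

section \<open>Distinct values from few collisions, and points along chains\<close>

text \<open>Expanding the sum of \<open>(1 - t * c v)^2 \<ge> 0\<close> over the fibre sizes
  \<open>c v\<close> gives a Cauchy--Schwarz bound that is linear in the number of collisions, so it
  can be summed over many maps with one common \<open>t\<close>.\<close>

lemma card_image_ge_collisions:
  fixes f :: "'a \<Rightarrow> 'b" and t :: real
  assumes "finite Y"
  shows "2 * t * real (card Y) - t\<^sup>2 * real (card {(y, y') \<in> Y \<times> Y. f y = f y'}) \<le> real (card (f ` Y))"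
proof -
  define c where "c v = real (card {y \<in> Y. f y = v})" for v
  have "real (card Y) = (\<Sum>v\<in>f ` Y. c v)"
    unfolding c_def of_nat_sum[symmetric] using assms
    by (subst card_eq_sum, subst sum.image_gen[of Y _ f]) auto
  moreover have "real (card {(y, y') \<in> Y \<times> Y. f y = f y'}) = (\<Sum>v\<in>f ` Y. (c v)\<^sup>2)"
  proof -
    have "{(y, y') \<in> Y \<times> Y. f y = f y'} = (\<Union>v\<in>f ` Y. {y \<in> Y. f y = v} \<times> {y \<in> Y. f y = v})" by auto
    also have "card \<dots> = (\<Sum>v\<in>f ` Y. card ({y \<in> Y. f y = v} \<times> {y \<in> Y. f y = v}))"
      using assms by (intro card_UN_disjoint) auto
    finally show ?thesis by (simp add: c_def card_cartesian_product power2_eq_square)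
  qed
  moreover have "0 \<le> (\<Sum>v\<in>f ` Y. (1 - t * c v)\<^sup>2)" by (intro sum_nonneg) auto
  moreover have "(\<Sum>v\<in>f ` Y. (1 - t * c v)\<^sup>2) = real (card (f ` Y)) - 2 * t * (\<Sum>v\<in>f ` Y. c v) + t\<^sup>2 * (\<Sum>v\<in>f ` Y. (c v)\<^sup>2)"
    by (simp add: power2_diff sum.distrib sum_subtractf sum_distrib_left power_mult_distrib mult_ac)
  ultimately show ?thesis by simp
qed

lemma card_chain_ge:
  assumes "\<And>i. finite (A i)" "\<And>i j. i \<le> j \<Longrightarrow> A i \<subseteq> A j"
    and strict: "\<And>i. a \<le> i \<Longrightarrow> i < b \<Longrightarrow> A i \<noteq> A (Suc i)" and "a \<le> i" "i \<le> j" "j \<le> b"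
  shows "card (A i) + (j - i) \<le> card (A j)"
  using \<open>i \<le> j\<close> \<open>j \<le> b\<close>
proof (induction j rule: dec_induct)
  case (step n)
  have "card (A n) < card (A (Suc n))"
    using assms(1) assms(2)[of n "Suc n"] strict[of n] step \<open>a \<le> i\<close> by (intro psubset_card_mono) auto
  then show ?case using step by linarith
qed simp

text \<open>For a fixed size \<open>|A i| + |B j|\<close>, exchanging a vertex of the light part for one of the heavy part
  raises the value by at least half the gap. So the windows of length \<open>L\<close> above the values
  of \<open>A i \<union> B j\<close> overlap only boundedly often.\<close>

lemma card_points_ge:
  fixes A B :: "nat \<Rightarrow> 'a set" and \<omega> :: "'a \<Rightarrow> nat"
  assumes E: "\<And>e. e \<in> E \<Longrightarrow> card e = 2"
    and fin: "finite V1" "finite V2" "finite Y"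
    and dis: "V1 \<inter> V2 = {}" "(V1 \<union> V2) \<inter> Y = {}"
    and A: "\<And>i. A i \<subseteq> V1" "\<And>i j. i \<le> j \<Longrightarrow> A i \<subseteq> A j"
      "\<And>i. a \<le> i \<Longrightarrow> i < b \<Longrightarrow> A i \<noteq> A (Suc i)"
    and B: "\<And>i. B i \<subseteq> V2" "\<And>i j. i \<le> j \<Longrightarrow> B i \<subseteq> B j"
      "\<And>i. a \<le> i \<Longrightarrow> i < b \<Longrightarrow> B i \<noteq> B (Suc i)"
    and low: "\<And>x. x \<in> V1 \<Longrightarrow> \<omega> x \<le> \<alpha>" and high: "\<And>x. x \<in> V2 \<Longrightarrow> \<alpha> + gap \<le> \<omega> x"
    and gap: "0 < gap" "2 * (card V1 + card V2) \<le> gap"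
    and L: "\<And>y. y \<in> Y \<Longrightarrow> card V1 + card V2 + \<omega> y \<le> L"
    and P: "finite P" "\<And>X. X \<subseteq> V1 \<union> V2 \<union> Y \<Longrightarrow> (card X, val E \<omega> X) \<in> P"
  shows "(\<Sum>i\<in>{a..<b}. \<Sum>j\<in>{a..<b}. real (card ((\<lambda>y. deg E (A i \<union> B j) y + \<omega> y) ` Y)))
     \<le> (2 * real L / real gap + 1) * real (card P)"
proof -
  define I where "I = {a..<b}"
  define f where "f i j y = deg E (A i \<union> B j) y + \<omega> y" for i j y
  \<comment> \<open>The points reached from \<open>A i \<union> B j\<close> by adding one vertex of
    \<open>Y\<close>; the \<open>Suc\<close> accounts for that vertex.\<close>
  define F where "F i j = (\<lambda>v. (Suc (card (A i) + card (B j)), val E \<omega> (A i \<union> B j) + v)) ` (f i j ` Y)" for i j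
  have finAB: "finite (A i)" "finite (B i)" for i using A(1) B(1) fin finite_subset by metis+
  have disAB: "A i \<inter> B j = {}" for i j using A(1) B(1) dis by blast
  have cardF: "card (F i j) = card (f i j ` Y)" for i j
    unfolding F_def by (rule card_image) (auto simp: inj_on_def)
  have FP: "F i j \<subseteq> P" for i j
  proof (clarsimp simp: F_def)
    fix y assume y: "y \<in> Y"
    then have "y \<notin> A i \<union> B j" using A(1) B(1) dis by blast
    then have "card (insert y (A i \<union> B j)) = Suc (card (A i) + card (B j))"
      "val E \<omega> (insert y (A i \<union> B j)) = val E \<omega> (A i \<union> B j) + f i j y"
      using finAB disAB val_insert[of E "A i \<union> B j" y \<omega>, OF E] by (auto simp: card_Un_disjoint f_def)
    moreover have "insert y (A i \<union> B j) \<subseteq> V1 \<union> V2 \<union> Y" using y A(1) B(1) by blast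
    ultimately show "(Suc (card (A i) + card (B j)), val E \<omega> (A i \<union> B j) + f i j y) \<in> P"
      using P(2) by metis
  qed
  have mult: "real (card {(i, j) \<in> I \<times> I. p \<in> F i j}) \<le> 2 * real L / real gap + 1" for p
  proof -
    define S where "S = {(i, j) \<in> I \<times> I. p \<in> F i j}"
    have finS: "finite S" by (rule finite_subset[of _ "I \<times> I"]) (auto simp: S_def I_def)
    have cards: "card (A i) + card (B j) = card (A i') + card (B j')" if "(i, j) \<in> S" "(i', j') \<in> S" for i j i' j'
      using that by (auto simp: S_def F_def)
    have Bmono: "card (B j) < card (B j')" if "j \<in> I" "j' \<in> I" "j < j'" for j j'
      using card_chain_ge[of B a b j j'] that finAB B by (auto simp: I_def)
    \<comment> \<open>The first coordinate of \<open>p\<close> fixes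
      \<open>card (A i) + card (B j)\<close>, so \<open>i\<close> determines
      \<open>card (B j)\<close> and, by strict growth, \<open>j\<close>. Hence it suffices to count
      the values of \<open>i\<close>.\<close>
    have inj: "inj_on fst S"
    proof (rule inj_onI, clarsimp)
      fix i j j' assume ij: "(i, j) \<in> S" "(i, j') \<in> S"
      then have "card (B j) = card (B j')" using cards by fastforce
      moreover have "j \<in> I" "j' \<in> I" using ij by (auto simp: S_def)
      ultimately show "j = j'" using Bmono by (metis less_irrefl nat_neq_iff)
    qed
    have "real (card (fst ` S)) \<le> 2 * real L / real gap + 1"
    proof (rule card_le_of_diff_le)
      fix i i' assume "i \<in> fst ` S" "i' \<in> fst ` S" and ii: "i < i'"
      then obtain j j' where ij: "(i, j) \<in> S" "(i', j') \<in> S" by auto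
      have I: "i \<in> I" "i' \<in> I" "j \<in> I" "j' \<in> I" using ij by (auto simp: S_def)
      have cAi: "card (A i) + (i' - i) \<le> card (A i')"
        using card_chain_ge[of A a b i i'] ii I finAB A by (auto simp: I_def)
      have "card (B j') < card (B j)" using cards[OF ij] cAi ii by linarith
      then have "j' \<le> j" using Bmono[OF I(3,4)] by (metis not_less_iff_gr_or_eq le_eq_less_or_eq linorder_not_le)
      then have BB: "B j' \<subseteq> B j" by (rule B(2))
      define g where "g = card (A i') - card (A i)"
      have "val E \<omega> (A i' \<union> B j') + g * gap \<le> val E \<omega> (A i \<union> B j) + g * (card V1 + card V2)"
        unfolding g_def
      proof (rule val_exchange_le[OF E])
        show "A i \<subseteq> A i'" using A(2) ii by simp
        show "card (A i') + card (B j') \<le> card V1 + card V2"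
          using A(1) B(1) fin by (intro add_mono card_mono) auto
        show "card (A i) + card (B j) = card (A i') + card (B j')" by (rule cards[OF ij])
        show "\<omega> x \<le> \<alpha>" if "x \<in> A i'" for x using low A(1) that by blast
        show "\<alpha> + gap \<le> \<omega> x" if "x \<in> B j" for x using high B(1) that by blast
      qed (use finAB BB disAB in auto)
      moreover have "val E \<omega> (A i \<union> B j) \<le> val E \<omega> (A i' \<union> B j') + L"
      proof -
        from ij obtain y y' where y: "y \<in> Y" "y' \<in> Y"
          "val E \<omega> (A i \<union> B j) + f i j y = val E \<omega> (A i' \<union> B j') + f i' j' y'"
          by (auto simp: S_def F_def)
        have "deg E (A i' \<union> B j') y' \<le> card (V1 \<union> V2)"
          using A(1) B(1) fin deg_le[of "A i' \<union> B j'" E y'] finAB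
            card_mono[of "V1 \<union> V2" "A i' \<union> B j'"] by (meson Un_mono finite_UnI order_trans)
        also have "\<dots> \<le> card V1 + card V2" by (rule card_Un_le)
        finally have "f i' j' y' \<le> L" using L[OF y(2)] by (simp add: f_def)
        then show ?thesis using y(3) by linarith
      qed
      \<comment> \<open>The edges can recover at most half of the weight loss
        \<open>g * gap\<close>. As the two values differ by at most \<open>L\<close>, this bounds
        \<open>g\<close> by \<open>2 L / gap\<close>.\<close>
      moreover have "g * (2 * (card V1 + card V2)) \<le> g * gap" using gap by (intro mult_left_mono) auto
      ultimately have "g * gap \<le> 2 * L" by (simp add: algebra_simps)
      then have "real g * real gap \<le> 2 * real L" by (metis of_nat_le_iff of_nat_mult of_nat_numeral)
      then have "real g \<le> 2 * real L / real gap" using gap by (simp add: field_simps)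
      moreover have "i' - i \<le> g" using cAi by (simp add: g_def)
      ultimately show "real i' - real i \<le> 2 * real L / real gap" by linarith
    qed (use finS in auto)
    then show ?thesis using card_image[OF inj] by (simp add: S_def)
  qed
  \<comment> \<open>Double counting of incidences between index pairs and points.\<close>
  have "(\<Sum>i\<in>I. \<Sum>j\<in>I. real (card (f i j ` Y))) = (\<Sum>(i, j)\<in>I \<times> I. real (card (F i j)))"
    by (simp add: sum.cartesian_product cardF)
  also have "\<dots> = (\<Sum>(i, j)\<in>I \<times> I. \<Sum>p\<in>P. if p \<in> F i j then 1 else 0)"
  proof (rule sum.cong[OF refl], clarify)
    fix i j
    have "P \<inter> F i j = F i j" using FP by auto
    then show "real (card (F i j)) = (\<Sum>p\<in>P. if p \<in> F i j then 1 else 0)"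
      using P(1) by (simp add: sum.If_cases Int_def)
  qed
  also have "\<dots> = (\<Sum>p\<in>P. \<Sum>(i, j)\<in>I \<times> I. if p \<in> F i j then 1 else 0)"
    by (subst sum.swap) (simp add: case_prod_unfold)
  also have "\<dots> = (\<Sum>p\<in>P. real (card {(i, j) \<in> I \<times> I. p \<in> F i j}))"
    by (rule sum.cong[OF refl])
      (auto simp: case_prod_unfold sum.If_cases I_def intro!: arg_cong[of _ _ card])
  also have "\<dots> \<le> (\<Sum>p\<in>P. 2 * real L / real gap + 1)" by (intro sum_mono mult)
  finally show ?thesis by (simp add: I_def f_def mult.commute)
qed

subsection \<open>Counting collisions\<close>

lemma sum_inverse_le_ln: "M > 0 \<Longrightarrow> (\<Sum>k\<in>{1..M}. 1 / real k) \<le> 1 + ln (real M)"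
proof (induction M rule: nat_induct_non_zero)
  case (Suc n)
  have "ln (real n / real (Suc n)) \<le> real n / real (Suc n) - 1"
    using Suc by (intro ln_le_minus_one) auto
  moreover have "real n / real (Suc n) - 1 = - (1 / real (Suc n))" by (simp add: field_simps)
  moreover have "ln (real n / real (Suc n)) = ln (real n) - ln (real (Suc n))"
    using Suc by (simp add: ln_div)
  ultimately show ?case using Suc by simp
qed simp

text \<open>By injectivity the distances from \<open>\<omega> y\<close> to the larger weights are
  distinct numbers in \<open>{1..M}\<close>, and likewise for the smaller weights, so each half is
  dominated by a harmonic sum.\<close>

lemma sum_inverse_dist_le:
  fixes \<omega> :: "'a \<Rightarrow> nat"
  assumes "finite Y" "inj_on \<omega> Y" "y \<in> Y" "\<And>z. z \<in> Y \<Longrightarrow> \<omega> z \<le> M" "M > 0"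
  shows "(\<Sum>z\<in>Y - {y}. 1 / \<bar>real (\<omega> z) - real (\<omega> y)\<bar>) \<le> 2 * (1 + ln (real M))"
proof -
  have part: "(\<Sum>z\<in>Z. 1 / \<bar>real (\<omega> z) - real (\<omega> y)\<bar>) \<le> 1 + ln (real M)"
    if Z: "Z \<subseteq> Y - {y}" and g: "inj_on g Z" "\<And>z. z \<in> Z \<Longrightarrow> real (g z) = \<bar>real (\<omega> z) - real (\<omega> y)\<bar>" for Z and g :: "'a \<Rightarrow> nat"
  proof -
    have "(\<Sum>z\<in>Z. 1 / \<bar>real (\<omega> z) - real (\<omega> y)\<bar>) = (\<Sum>k\<in>g ` Z. 1 / real k)"
      using g by (subst sum.reindex) auto
    also have "\<dots> \<le> (\<Sum>k\<in>{1..M}. 1 / real k)"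
    proof (rule sum_mono2)
      show "g ` Z \<subseteq> {1..M}"
      proof clarify
        fix z assume z: "z \<in> Z"
        then have "\<omega> z \<noteq> \<omega> y" using Z assms by (metis DiffE inj_onD insertI1 subsetD)
        then have "real (g z) > 0" using g(2)[OF z] by simp
        moreover have "\<omega> z \<le> M" "\<omega> y \<le> M" using z Z assms by auto
        then have "real (g z) \<le> real M" using g(2)[OF z] by linarith
        ultimately show "g z \<in> {1..M}" by simp
      qed
    qed auto
    also have "\<dots> \<le> 1 + ln (real M)" by (rule sum_inverse_le_ln) fact
    finally show ?thesis .
  qed
  define Z1 where "Z1 = {z \<in> Y - {y}. \<omega> z \<ge> \<omega> y}"
  define Z2 where "Z2 = {z \<in> Y - {y}. \<omega> z < \<omega> y}"
  have eq: "(\<Sum>z\<in>Y - {y}. 1 / \<bar>real (\<omega> z) - real (\<omega> y)\<bar>)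
     = (\<Sum>z\<in>Z1. 1 / \<bar>real (\<omega> z) - real (\<omega> y)\<bar>) + (\<Sum>z\<in>Z2. 1 / \<bar>real (\<omega> z) - real (\<omega> y)\<bar>)"
    using assms(1) by (subst sum.union_disjoint[symmetric]) (auto simp: Z1_def Z2_def intro!: sum.cong)
  have "(\<Sum>z\<in>Z1. 1 / \<bar>real (\<omega> z) - real (\<omega> y)\<bar>) \<le> 1 + ln (real M)"
  proof (rule part)
    show "inj_on (\<lambda>z. \<omega> z - \<omega> y) Z1"
      using assms(2) by (auto simp: inj_on_def Z1_def)
  qed (auto simp: Z1_def)
  moreover have "(\<Sum>z\<in>Z2. 1 / \<bar>real (\<omega> z) - real (\<omega> y)\<bar>) \<le> 1 + ln (real M)"
  proof (rule part)
    show "inj_on (\<lambda>z. \<omega> y - \<omega> z) Z2"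
      using assms(2) by (auto simp: inj_on_def Z2_def)
  qed (auto simp: Z2_def)
  ultimately have "(\<Sum>z\<in>Y - {y}. 1 / \<bar>real (\<omega> z) - real (\<omega> y)\<bar>) \<le> (1 + ln (real M)) + (1 + ln (real M))"
    unfolding eq by (rule add_mono)
  then show ?thesis by simp
qed

text \<open>Each vertex of \<open>V\<close> avoids \<open>c\<close> independently with probability
  \<open>1 - 1/M \<le> exp (- 1/M)\<close>. A union bound over \<open>c\<close> later ensures that
  every middle label occurs, which makes the chains strictly increasing.\<close>

lemma card_PiE_avoid_le:
  assumes "finite U" "V \<subseteq> U" "M > 0" "c < M"
  shows "real (card {l \<in> U \<rightarrow>\<^sub>E {..<M}. \<forall>x\<in>V. l x \<noteq> c}) \<le> exp (- (real (card V) / real M)) * real M ^ card U"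
proof -
  have fV: "finite V" using assms finite_subset by auto
  have "{l \<in> U \<rightarrow>\<^sub>E {..<M}. \<forall>x\<in>V. l x \<noteq> c} = (\<Pi>\<^sub>E x\<in>U. if x \<in> V then {..<M} - {c} else {..<M})"
    using assms(2) by (auto simp: PiE_iff extensional_def split: if_splits)
  then have "card {l \<in> U \<rightarrow>\<^sub>E {..<M}. \<forall>x\<in>V. l x \<noteq> c} = (\<Prod>x\<in>U. if x \<in> V then M - 1 else M)"
    using assms by (simp add: card_PiE if_distrib cong: if_cong)
  also have "\<dots> = (M - 1) ^ card V * M ^ (card U - card V)"
  proof -
    have "U \<inter> {x. x \<in> V} = V" "U \<inter> - {x. x \<in> V} = U - V" using assms(2) by auto
    then show ?thesis using assms fV by (simp add: prod.If_cases card_Diff_subset)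
  qed
  finally have "real (card {l \<in> U \<rightarrow>\<^sub>E {..<M}. \<forall>x\<in>V. l x \<noteq> c}) = (real M - 1) ^ card V * real M ^ (card U - card V)"
    using assms(3) by (simp add: of_nat_diff)
  also have "\<dots> \<le> (real M * exp (- (1 / real M))) ^ card V * real M ^ (card U - card V)"
  proof (intro mult_right_mono power_mono)
    have "real M * (1 - 1 / real M) \<le> real M * exp (- (1 / real M))"
      using exp_ge_add_one_self[of "- (1 / real M)"] by (intro mult_left_mono) auto
    then show "real M - 1 \<le> real M * exp (- (1 / real M))" using assms(3) by (simp add: algebra_simps)
  qed (use assms(3) in auto)
  also have "\<dots> = exp (- (real (card V) / real M)) * (real M ^ card V * real M ^ (card U - card V))"
    by (simp add: power_mult_distrib exp_of_nat_mult[symmetric])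
  also have "real M ^ card V * real M ^ (card U - card V) = real M ^ card U"
    using card_mono[OF assms(1,2)] by (simp flip: power_add)
  finally show ?thesis .
qed

text \<open>For a random \<open>H\<close> this turns a collision into a label sum with coefficients
  in \<open>{-1, 0, 1}\<close>, as the tail and anticoncentration bounds require.\<close>

lemma deg_diff_eq_sum:
  assumes "finite U" "H \<subseteq> U"
  shows "int (deg E H y) - int (deg E H y') = (\<Sum>x\<in>U. if x \<in> H then of_bool ({x, y} \<in> E) - of_bool ({x, y'} \<in> E) else 0)"
proof -
  have "int (deg E H z) = (\<Sum>x\<in>U. if x \<in> H then of_bool ({x, z} \<in> E) else 0)" for z
  proof -
    have "U \<inter> {x. x \<in> H \<and> {x, z} \<in> E} = {x \<in> H. {x, z} \<in> E}" using assms by auto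
    then have "int (deg E H z) = (\<Sum>x\<in>U. if x \<in> H \<and> {x, z} \<in> E then 1 else 0)"
      using assms by (simp add: deg_def sum.If_cases)
    then show ?thesis by (auto intro!: sum.cong)
  qed
  then show ?thesis by (simp flip: sum_subtractf) (auto intro!: sum.cong)
qed

section \<open>A labelling with few collisions\<close>

text \<open>A first-moment argument over all labellings. In \<open>\<kappa>\<close> the term with
  \<open>s\<close> pays for near-twins, the one with \<open>\<tau>\<close> for the Chernoff tail,
  the one with \<open>Hm\<close> for index pairs whose mean is near the target, and the last for the
  additive \<open>2N\<close> in the drift count. Fewer than half of the labellings miss a middle
  label, so one of the others has at most twice the average.\<close>

lemma ex_labelling:
  fixes E :: "'a set set" and \<omega> :: "'a \<Rightarrow> nat" and R D Hm s :: real
  assumes fin: "finite V1" "finite V2" "finite Y" and dis: "V1 \<inter> V2 = {}"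
    and u: "card V1 = u" "card V2 = u" and N: "N > 0"
    and inj: "inj_on \<omega> Y"
    and R: "0 \<le> R" "R \<le> D / 4" and D: "D > 0"
    and close: "\<And>y. y \<in> Y \<Longrightarrow> real (card {y' \<in> Y. real (card {x \<in> V1 \<union> V2. ({x, y} \<in> E) \<noteq> ({x, y'} \<in> E)}) < D}) \<le> s"
    and harm: "\<And>y. y \<in> Y \<Longrightarrow> (\<Sum>z\<in>Y - {y}. 1 / \<bar>real (\<omega> z) - real (\<omega> y)\<bar>) \<le> Hm"
    and cover: "8 * real N * exp (- (real u / (4 * real N))) < 1"
    and \<tau>: "\<tau> = exp (- (R\<^sup>2 / (8 * real u)))" and p: "p = \<tau> + 2 / sqrt D"
    and \<kappa>: "\<kappa> = 4 * s + 4 * \<tau> * card Y + 48 * R * p * Hm + 2 * p * card Y / real N"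
  shows "\<exists>l. (\<forall>c\<in>{N..<3*N}. (\<exists>x\<in>V1. l x = c) \<and> (\<exists>x\<in>V2. l x = c)) \<and>
     (\<Sum>i\<in>{N..<3*N}. \<Sum>j\<in>{N..<3*N}. real (card {(y, y') \<in> Y \<times> Y.
        deg E ({x \<in> V1. l x < i} \<union> {x \<in> V2. l x < j}) y + \<omega> y
      = deg E ({x \<in> V1. l x < i} \<union> {x \<in> V2. l x < j}) y' + \<omega> y'})) \<le> 2 * (real N)\<^sup>2 * card Y * \<kappa>"
proof -
  define U where "U = V1 \<union> V2"
  define I where "I = {N..<3*N}"
  define \<Omega> where "\<Omega> = (U \<rightarrow>\<^sub>E {..<4*N})"
  define M where "M = real (4*N) ^ card U"
  define H where "H l i j = {x \<in> V1. l x < i} \<union> {x \<in> V2. l x < j}" for l :: "'a \<Rightarrow> nat" and i j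
  define f where "f l i j y = deg E (H l i j) y + \<omega> y" for l i j y
  define coll where "coll l = (\<Sum>i\<in>I. \<Sum>j\<in>I. real (card {(y, y') \<in> Y \<times> Y. f l i j y = f l i j y'}))" for l
  have finU: "finite U" using fin by (simp add: U_def)
  have cU: "card U = 2 * u" using fin dis u by (simp add: U_def card_Un_disjoint)
  have fin\<Omega>: "finite \<Omega>" using finU by (simp add: \<Omega>_def finite_PiE)
  have card\<Omega>: "real (card \<Omega>) = M" using finU by (simp add: \<Omega>_def M_def card_PiE)
  have M0: "M > 0" using N by (simp add: M_def)
  have cI: "card I = 2 * N" "finite I" by (auto simp: I_def)
  have \<tau>0: "\<tau> > 0" by (simp add: \<tau>)
  have p0: "p > 0" using \<tau>0 D by (simp add: p add_pos_pos)
  define \<phi> where "\<phi> y y' x = (of_bool ({x, y} \<in> E) - of_bool ({x, y'} \<in> E) :: int)" for y y' x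
  \<comment> \<open>With these thresholds \<open>H l i j\<close> consists of the
    \<open>x \<in> U\<close> with \<open>l x < thr i j x\<close>.\<close>
  define thr where "thr i j x = (if x \<in> V1 then i else j)" for i j :: nat and x
  define q where "q i j y y' = real (card {l \<in> \<Omega>. f l i j y = f l i j y'})" for i j y y'
  have \<phi>1: "\<bar>\<phi> y y' x\<bar> \<le> 1" for y y' x by (auto simp: \<phi>_def)
  have set_eq: "{l \<in> \<Omega>. f l i j y = f l i j y'} =
      {l \<in> U \<rightarrow>\<^sub>E {..<4*N}. (\<Sum>x\<in>U. if l x < thr i j x then \<phi> y y' x else 0) = int (\<omega> y') - int (\<omega> y)}" for i j y y'
  proof -
    have "f l i j y = f l i j y' \<longleftrightarrow> (\<Sum>x\<in>U. if l x < thr i j x then \<phi> y y' x else 0) = int (\<omega> y') - int (\<omega> y)" for l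
    proof -
      have "f l i j y = f l i j y' \<longleftrightarrow> int (deg E (H l i j) y) - int (deg E (H l i j) y') = int (\<omega> y') - int (\<omega> y)"
        by (auto simp: f_def)
      also have "int (deg E (H l i j) y) - int (deg E (H l i j) y') = (\<Sum>x\<in>U. if x \<in> H l i j then \<phi> y y' x else 0)"
        unfolding \<phi>_def by (rule deg_diff_eq_sum[OF finU]) (auto simp: H_def U_def)
      also have "\<dots> = (\<Sum>x\<in>U. if l x < thr i j x then \<phi> y y' x else 0)"
        by (rule sum.cong[OF refl]) (use dis in \<open>auto simp: H_def U_def thr_def\<close>)
      finally show ?thesis .
    qed
    then show ?thesis by (auto simp: \<Omega>_def)
  qed
  have q_triv: "q i j y y' \<le> M" for i j y y'
    unfolding q_def card\<Omega>[symmetric] using fin\<Omega> by (intro of_nat_mono card_mono) auto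
  define close_set where "close_set y = {y' \<in> Y. real (card {x \<in> U. ({x, y} \<in> E) \<noteq> ({x, y'} \<in> E)}) < D}" for y
  have far: "(\<Sum>i\<in>I. \<Sum>j\<in>I. q i j y y') \<le>
      (4 * (real N)\<^sup>2 * \<tau> + (48 * (real N)\<^sup>2 * R * (1 / \<bar>real (\<omega> y') - real (\<omega> y)\<bar>) + 2 * real N) * p) * M"
    if y: "y \<in> Y" "y' \<in> Y" "y' \<notin> close_set y" "y' \<noteq> y" for y y'
  proof -
    define m where "m = real_of_int (int (\<omega> y') - int (\<omega> y))"
    have m0: "m \<noteq> 0" using inj y by (auto simp: m_def inj_on_def)
    have cD: "{x \<in> U. \<phi> y y' x \<noteq> 0} = {x \<in> U. ({x, y} \<in> E) \<noteq> ({x, y'} \<in> E)}"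
      by (auto simp: \<phi>_def)
    define d where "d = real (card {x \<in> U. \<phi> y y' x \<noteq> 0})"
    have d: "D \<le> d" using y by (simp add: close_set_def cD d_def)
    then have d0: "0 < card {x \<in> U. \<phi> y y' x \<noteq> 0}" using D by (simp add: d_def)
    have dU: "d \<le> real (card U)" unfolding d_def using finU by (intro of_nat_mono card_mono) auto
    have c4: "4 * card U = 8 * u" by (simp add: cU)
    define \<Delta>1 where "\<Delta>1 = (\<Sum>x\<in>V1. real_of_int (\<phi> y y' x))"
    define \<Delta>2 where "\<Delta>2 = (\<Sum>x\<in>V2. real_of_int (\<phi> y y' x))"
    have mean: "(\<Sum>x\<in>U. real_of_int (\<phi> y y' x) * real (thr i j x)) = real i * \<Delta>1 + real j * \<Delta>2" for i j
    proof -
      have "(\<Sum>x\<in>U. real_of_int (\<phi> y y' x) * real (thr i j x))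
        = (\<Sum>x\<in>V1. real_of_int (\<phi> y y' x) * real (thr i j x)) + (\<Sum>x\<in>V2. real_of_int (\<phi> y y' x) * real (thr i j x))"
        unfolding U_def by (rule sum.union_disjoint[OF fin(1,2) dis])
      moreover have "(\<Sum>x\<in>V1. real_of_int (\<phi> y y' x) * real (thr i j x)) = (\<Sum>x\<in>V1. real i * real_of_int (\<phi> y y' x))"
        by (rule sum.cong) (auto simp: thr_def)
      moreover have "(\<Sum>x\<in>V2. real_of_int (\<phi> y y' x) * real (thr i j x)) = (\<Sum>x\<in>V2. real j * real_of_int (\<phi> y y' x))"
        by (rule sum.cong) (use dis in \<open>auto simp: thr_def\<close>)
      ultimately show ?thesis by (simp add: \<Delta>1_def \<Delta>2_def sum_distrib_left)
    qed
    define W where "W = {(i, j) \<in> I \<times> I. \<bar>(real i * \<Delta>1 + real j * \<Delta>2) / (4 * real N) - m\<bar> \<le> R}"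
    \<comment> \<open>On \<open>W\<close>, where the mean is within \<open>R\<close> of
      \<open>m\<close>, anticoncentration applies; elsewhere the tail bound does. Both exponentials
      equal \<open>\<tau>\<close> because \<open>4 * card U = 8 * u\<close>.\<close>
    have q_le: "q i j y y' \<le> (\<tau> + (if (i, j) \<in> W then p else 0)) * M" if ij: "i \<in> I" "j \<in> I" for i j
    proof (cases "(i, j) \<in> W")
      case True
      have "q i j y y' \<le> (exp (- (R\<^sup>2 / (4 * card U))) + 2 / sqrt d) * real (4 * N) ^ card U"
        unfolding q_def set_eq d_def
        by (rule PiE_anticoncentration[OF finU N])
           (use ij \<phi>1 R d d0 in \<open>auto simp: thr_def I_def d_def[symmetric]\<close>)
      also have "\<dots> \<le> p * M"
        unfolding M_def p \<tau> c4 using D d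
        by (intro mult_right_mono add_mono) (auto intro!: divide_left_mono)
      also have "\<dots> \<le> (\<tau> + p) * M" using \<tau>0 M0 by simp
      finally show ?thesis using True by simp
    next
      case False
      have "q i j y y' \<le> exp (- (R\<^sup>2 / (4 * card U))) * real (4 * N) ^ card U"
        unfolding q_def set_eq
      proof (rule PiE_tail_sum[OF finU N])
        show "R \<le> \<bar>(\<Sum>x\<in>U. real_of_int (\<phi> y y' x) * real (thr i j x)) / (4 * real N) - real_of_int (int (\<omega> y') - int (\<omega> y))\<bar>"
          using False ij by (simp add: mean W_def m_def)
        show "R \<le> 2 * real (card U)" using R d dU D by linarith
      qed (use ij \<phi>1 R in \<open>auto simp: thr_def I_def\<close>)
      then show ?thesis using False c4 by (simp add: M_def \<tau>)
    qed
    have cW: "real (card W) \<le> 48 * (real N)\<^sup>2 * R / \<bar>m\<bar> + 2 * real N"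
      unfolding W_def I_def by (rule card_drift_le[OF N m0 R(1)])
    have "(\<Sum>i\<in>I. \<Sum>j\<in>I. q i j y y') \<le> (\<Sum>i\<in>I. \<Sum>j\<in>I. (\<tau> + (if (i, j) \<in> W then p else 0)) * M)"
      by (intro sum_mono q_le)
    also have "\<dots> = (4 * (real N)\<^sup>2 * \<tau> + real (card W) * p) * M"
    proof -
      have "(\<Sum>i\<in>I. \<Sum>j\<in>I. (if (i, j) \<in> W then p else 0)) = (\<Sum>ij\<in>I \<times> I. if ij \<in> W then p else 0)"
        by (simp add: sum.cartesian_product case_prod_unfold)
      also have "\<dots> = real (card ((I \<times> I) \<inter> W)) * p"
        using cI by (subst sum.If_cases) auto
      also have "(I \<times> I) \<inter> W = W" by (auto simp: W_def)
      finally have "(\<Sum>i\<in>I. \<Sum>j\<in>I. (if (i, j) \<in> W then p else 0)) = real (card W) * p" .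
      then show ?thesis
        by (simp add: sum.distrib sum_distrib_right[symmetric] cI power2_eq_square)
    qed
    also have "\<dots> \<le> (4 * (real N)\<^sup>2 * \<tau> + (48 * (real N)\<^sup>2 * R / \<bar>m\<bar> + 2 * real N) * p) * M"
      using cW p0 M0 by (intro mult_right_mono add_left_mono) auto
    finally show ?thesis by (simp add: m_def)
  qed
  have coll_total: "(\<Sum>l\<in>\<Omega>. coll l) \<le> (real N)\<^sup>2 * card Y * \<kappa> * M"
  proof -
    have "(\<Sum>l\<in>\<Omega>. coll l) = (\<Sum>l\<in>\<Omega>. \<Sum>i\<in>I. \<Sum>j\<in>I. \<Sum>y\<in>Y. \<Sum>y'\<in>Y. if f l i j y = f l i j y' then 1 else 0)"
      unfolding coll_def
    proof (intro sum.cong refl)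
      fix l i j
      have "real (card {(y, y') \<in> Y \<times> Y. f l i j y = f l i j y'})
         = (\<Sum>z\<in>Y \<times> Y. if f l i j (fst z) = f l i j (snd z) then 1 else 0)"
        using fin by (subst sum.If_cases) (auto simp: case_prod_unfold Int_def intro!: arg_cong[of _ _ card])
      then show "real (card {(y, y') \<in> Y \<times> Y. f l i j y = f l i j y'})
         = (\<Sum>y\<in>Y. \<Sum>y'\<in>Y. if f l i j y = f l i j y' then 1 else 0)"
        by (simp add: sum.cartesian_product case_prod_unfold)
    qed
    \<comment> \<open>The sum over \<open>l\<close> moves innermost, where it counts
      \<open>q i j y y'\<close>; then \<open>i\<close> and \<open>j\<close> move inside
      \<open>y\<close> and \<open>y'\<close>, to match \<open>far\<close>.\<close>
    also have "\<dots> = (\<Sum>i\<in>I. \<Sum>l\<in>\<Omega>. \<Sum>j\<in>I. \<Sum>y\<in>Y. \<Sum>y'\<in>Y. if f l i j y = f l i j y' then 1 else 0)"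
      by (rule sum.swap)
    also have "\<dots> = (\<Sum>i\<in>I. \<Sum>j\<in>I. \<Sum>l\<in>\<Omega>. \<Sum>y\<in>Y. \<Sum>y'\<in>Y. if f l i j y = f l i j y' then 1 else 0)"
      by (rule sum.cong[OF refl], rule sum.swap)
    also have "\<dots> = (\<Sum>i\<in>I. \<Sum>j\<in>I. \<Sum>y\<in>Y. \<Sum>l\<in>\<Omega>. \<Sum>y'\<in>Y. if f l i j y = f l i j y' then 1 else 0)"
      by (rule sum.cong[OF refl], rule sum.cong[OF refl], rule sum.swap)
    also have "\<dots> = (\<Sum>i\<in>I. \<Sum>j\<in>I. \<Sum>y\<in>Y. \<Sum>y'\<in>Y. \<Sum>l\<in>\<Omega>. if f l i j y = f l i j y' then 1 else 0)"
      by (rule sum.cong[OF refl], rule sum.cong[OF refl], rule sum.cong[OF refl], rule sum.swap)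
    also have "\<dots> = (\<Sum>i\<in>I. \<Sum>j\<in>I. \<Sum>y\<in>Y. \<Sum>y'\<in>Y. q i j y y')"
      by (intro sum.cong refl) (simp add: q_def sum.If_cases fin\<Omega> Int_def)
    also have "\<dots> = (\<Sum>i\<in>I. \<Sum>y\<in>Y. \<Sum>j\<in>I. \<Sum>y'\<in>Y. q i j y y')"
      by (rule sum.cong[OF refl], rule sum.swap)
    also have "\<dots> = (\<Sum>y\<in>Y. \<Sum>i\<in>I. \<Sum>j\<in>I. \<Sum>y'\<in>Y. q i j y y')"
      by (rule sum.swap)
    also have "\<dots> = (\<Sum>y\<in>Y. \<Sum>i\<in>I. \<Sum>y'\<in>Y. \<Sum>j\<in>I. q i j y y')"
      by (rule sum.cong[OF refl], rule sum.cong[OF refl], rule sum.swap)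
    also have "\<dots> = (\<Sum>y\<in>Y. \<Sum>y'\<in>Y. \<Sum>i\<in>I. \<Sum>j\<in>I. q i j y y')"
      by (rule sum.cong[OF refl], rule sum.swap)
    also have "\<dots> \<le> (\<Sum>y\<in>Y. (real N)\<^sup>2 * \<kappa> * M)"
    proof (rule sum_mono)
      fix y assume y: "y \<in> Y"
      let ?g = "\<lambda>y'. 1 / \<bar>real (\<omega> y') - real (\<omega> y)\<bar>"
      have "D > real (card {x \<in> U. ({x, y} \<in> E) \<noteq> ({x, y} \<in> E)})" using D by simp
      then have yc: "y \<in> close_set y" using y by (simp add: close_set_def)
      have fc: "finite (close_set y)" "close_set y \<subseteq> Y" using fin by (auto simp: close_set_def)
      have "(\<Sum>y'\<in>Y. \<Sum>i\<in>I. \<Sum>j\<in>I. q i j y y')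
         = (\<Sum>y'\<in>Y - close_set y. \<Sum>i\<in>I. \<Sum>j\<in>I. q i j y y') + (\<Sum>y'\<in>close_set y. \<Sum>i\<in>I. \<Sum>j\<in>I. q i j y y')"
        by (rule sum.subset_diff) (use fc fin in auto)
      also have "(\<Sum>y'\<in>close_set y. \<Sum>i\<in>I. \<Sum>j\<in>I. q i j y y') \<le> (\<Sum>y'\<in>close_set y. \<Sum>i\<in>I. \<Sum>j\<in>I. M)"
        by (intro sum_mono q_triv)
      also have "\<dots> = real (card (close_set y)) * (4 * (real N)\<^sup>2 * M)"
        by (simp add: cI power2_eq_square)
      also have "\<dots> \<le> s * (4 * (real N)\<^sup>2 * M)"
        using close[OF y] M0 by (intro mult_right_mono) (auto simp: close_set_def U_def)
      also have "(\<Sum>y'\<in>Y - close_set y. \<Sum>i\<in>I. \<Sum>j\<in>I. q i j y y')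
        \<le> (\<Sum>y'\<in>Y - close_set y. (4 * (real N)\<^sup>2 * \<tau> + (48 * (real N)\<^sup>2 * R * ?g y' + 2 * real N) * p) * M)"
        by (intro sum_mono far) (use y yc in auto)
      \<comment> \<open>Since \<open>y\<close> is its own near-twin, the range only grows, to the
        one covered by \<open>harm\<close>; the terms are nonnegative.\<close>
      also have "\<dots> \<le> (\<Sum>y'\<in>Y - {y}. (4 * (real N)\<^sup>2 * \<tau> + (48 * (real N)\<^sup>2 * R * ?g y' + 2 * real N) * p) * M)"
        using fin yc \<tau>0 p0 M0 R by (intro sum_mono2) auto
      also have "\<dots> = real (card (Y - {y})) * ((4 * (real N)\<^sup>2 * \<tau> + 2 * real N * p) * M)
           + 48 * (real N)\<^sup>2 * R * p * M * (\<Sum>y'\<in>Y - {y}. ?g y')"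
        by (simp add: algebra_simps sum.distrib sum_distrib_left)
      also have "\<dots> \<le> real (card Y) * ((4 * (real N)\<^sup>2 * \<tau> + 2 * real N * p) * M)
           + 48 * (real N)\<^sup>2 * R * p * M * Hm"
        using fin \<tau>0 p0 M0 R harm[OF y]
        by (intro add_mono mult_right_mono mult_left_mono of_nat_mono card_mono) auto
      finally have "(\<Sum>y'\<in>Y. \<Sum>i\<in>I. \<Sum>j\<in>I. q i j y y') \<le>
          real (card Y) * ((4 * (real N)\<^sup>2 * \<tau> + 2 * real N * p) * M)
           + 48 * (real N)\<^sup>2 * R * p * M * Hm + s * (4 * (real N)\<^sup>2 * M)" by simp
      also have "\<dots> = (real N)\<^sup>2 * \<kappa> * M"
        using N by (simp add: \<kappa> field_simps power2_eq_square)
      finally show "(\<Sum>y'\<in>Y. \<Sum>i\<in>I. \<Sum>j\<in>I. q i j y y') \<le> (real N)\<^sup>2 * \<kappa> * M" .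
    qed
    finally show ?thesis by (simp add: mult_ac)
  qed
  define bad where "bad = (\<Union>c\<in>I. {l \<in> \<Omega>. \<forall>x\<in>V1. l x \<noteq> c} \<union> {l \<in> \<Omega>. \<forall>x\<in>V2. l x \<noteq> c})"
  have bad: "bad \<subseteq> \<Omega>" "finite bad" using fin\<Omega> by (auto simp: bad_def intro: finite_subset)
  have "real (card bad) < M / 2"
  proof -
    let ?b = "exp (- (real u / real (4*N))) * M"
    have "card bad \<le> (\<Sum>c\<in>I. card ({l \<in> \<Omega>. \<forall>x\<in>V1. l x \<noteq> c} \<union> {l \<in> \<Omega>. \<forall>x\<in>V2. l x \<noteq> c}))"
      unfolding bad_def by (rule card_UN_le) (use cI in auto)
    also have "\<dots> \<le> (\<Sum>c\<in>I. card {l \<in> \<Omega>. \<forall>x\<in>V1. l x \<noteq> c} + card {l \<in> \<Omega>. \<forall>x\<in>V2. l x \<noteq> c})"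
      by (intro sum_mono card_Un_le)
    finally have "real (card bad) \<le> (\<Sum>c\<in>I. real (card {l \<in> \<Omega>. \<forall>x\<in>V1. l x \<noteq> c}) + real (card {l \<in> \<Omega>. \<forall>x\<in>V2. l x \<noteq> c}))"
      by (metis (mono_tags, lifting) of_nat_add of_nat_le_iff of_nat_sum sum.cong)
    also have "\<dots> \<le> (\<Sum>c\<in>I. ?b + ?b)"
      using card_PiE_avoid_le[OF finU, of V1 "4*N"] card_PiE_avoid_le[OF finU, of V2 "4*N"] u N
      unfolding \<Omega>_def M_def by (intro sum_mono add_mono) (auto simp: U_def I_def)
    also have "\<dots> = (8 * real N * exp (- (real u / (4 * real N)))) * M / 2" by (simp add: cI)
    also have "\<dots> < 1 * M / 2" using cover M0 by (intro divide_strict_right_mono mult_strict_right_mono) auto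
    finally show ?thesis by simp
  qed
  then have good: "real (card (\<Omega> - bad)) > M / 2"
    using card_Diff_subset[OF bad(2,1)] card_mono[OF fin\<Omega> bad(1)] card\<Omega> by simp
  then have "0 < card (\<Omega> - bad)" using M0 by linarith
  then have ne: "\<Omega> - bad \<noteq> {}" by (metis card.empty less_irrefl)
  have coll0: "coll l \<ge> 0" for l unfolding coll_def by (intro sum_nonneg) auto
  define B where "B = (real N)\<^sup>2 * card Y * \<kappa>"
  have "0 \<le> B * M" using coll_total coll0 sum_nonneg[of \<Omega> coll] by (simp add: B_def)
  then have B0: "B \<ge> 0" using M0 by (simp add: zero_le_mult_iff)
  \<comment> \<open>Otherwise the labellings outside \<open>bad\<close>, more than half of all,
    would together exceed the total \<open>B * M\<close>.\<close>
  have "\<exists>l\<in>\<Omega> - bad. coll l \<le> 2 * B"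
  proof (rule ccontr)
    assume "\<not> ?thesis"
    then have "2 * B < coll l" if "l \<in> \<Omega> - bad" for l
      using that by (meson not_le)
    then have "(\<Sum>l\<in>\<Omega> - bad. 2 * B) < (\<Sum>l\<in>\<Omega> - bad. coll l)"
      using fin\<Omega> by (intro sum_strict_mono[OF _ ne]) auto
    also have "\<dots> \<le> (\<Sum>l\<in>\<Omega>. coll l)" using fin\<Omega> coll0 by (intro sum_mono2) auto
    also have "\<dots> \<le> B * M" using coll_total by (simp add: B_def)
    finally have "real (card (\<Omega> - bad)) * (2 * B) < B * M" by simp
    moreover have "M / 2 * (2 * B) \<le> real (card (\<Omega> - bad)) * (2 * B)"
      using good B0 by (intro mult_right_mono) auto
    ultimately show False by (simp add: mult.commute)
  qed
  then obtain l where l: "l \<in> \<Omega>" "l \<notin> bad" "coll l \<le> 2 * B" by auto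
  show ?thesis
  proof (intro exI[of _ l] conjI)
    show "\<forall>c\<in>{N..<3 * N}. (\<exists>x\<in>V1. l x = c) \<and> (\<exists>x\<in>V2. l x = c)"
      using l by (auto simp: bad_def I_def)
  qed (use l(3) in \<open>simp add: coll_def B_def f_def H_def I_def mult.assoc\<close>)
qed

subsection \<open>The number of pairs\<close>

lemma ex_lowest_subset:
  fixes f :: "'a \<Rightarrow> 'b::linorder"
  assumes "finite W" "k \<le> card W"
  shows "\<exists>V\<subseteq>W. card V = k \<and> (\<forall>x\<in>V. \<forall>y\<in>W - V. f x \<le> f y)"
  using assms(2)
proof (induction k)
  case (Suc k)
  then obtain V where V: "V \<subseteq> W" "card V = k" "\<forall>x\<in>V. \<forall>y\<in>W - V. f x \<le> f y" by auto
  have fV: "finite V" using V assms finite_subset by auto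
  have "W - V \<noteq> {}" using V Suc.prems by auto
  then obtain x where x: "x \<in> W - V" "\<And>y. y \<in> W - V \<Longrightarrow> f x \<le> f y"
    using ex_min_if_finite[of "f ` (W - V)"] assms(1)
    by (metis arg_min_if_finite(1) arg_min_least finite_Diff)
  have "card (insert x V) = Suc k" using x fV V by simp
  then show ?case using x V by (intro exI[of _ "insert x V"]) auto
qed auto

text \<open>Given too many near-twins of \<open>y\<close>, take about \<open>a\<close> of them as
  \<open>S\<close>. Their differences from \<open>y\<close> cover at most half of \<open>U\<close>;
  on the rest all of \<open>S\<close> agrees with \<open>y\<close>, so the neighbours or the
  non-neighbours of \<open>y\<close> there, at least a quarter of \<open>U\<close>, form a lopsided
  pair with \<open>S\<close>.\<close>

lemma card_close_less:
  fixes a K D :: real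
  assumes "finite W" and lop: "\<not> lopsided E a K W" and sub: "U \<subseteq> W" "Y \<subseteq> W" "U \<inter> Y = {}"
    and a: "a > 0" and D: "D * (a + 1) \<le> real (card U) / 2" and D0: "D \<ge> 0"
    and K: "4 * real (card W) \<le> K * real (card U)" "K \<ge> 0" and y: "y \<in> Y"
  shows "real (card {y' \<in> Y. real (card {x \<in> U. ({x, y} \<in> E) \<noteq> ({x, y'} \<in> E)}) < D}) < a"
proof (rule ccontr)
  let ?Cl = "{y' \<in> Y. real (card {x \<in> U. ({x, y} \<in> E) \<noteq> ({x, y'} \<in> E)}) < D}"
  assume "\<not> real (card ?Cl) < a"
  then have "nat \<lceil>a\<rceil> \<le> card ?Cl" by linarith
  then obtain S where S: "S \<subseteq> ?Cl" "card S = nat \<lceil>a\<rceil>" by (meson obtain_subset_with_card_n)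
  have fin: "finite U" "finite S" using assms S finite_subset[of S W] finite_subset[of U W] by auto
  have cS: "a \<le> real (card S)" "real (card S) \<le> a + 1" using a S(2) by linarith+
  define Z where "Z = (\<Union>y'\<in>S. {x \<in> U. ({x, y} \<in> E) \<noteq> ({x, y'} \<in> E)})"
  have "real (card Z) \<le> (\<Sum>y'\<in>S. real (card {x \<in> U. ({x, y} \<in> E) \<noteq> ({x, y'} \<in> E)}))"
    unfolding Z_def of_nat_sum[symmetric] using fin by (intro of_nat_mono card_UN_le)
  also have "\<dots> \<le> (\<Sum>y'\<in>S. D)" using S by (intro sum_mono) force
  also have "\<dots> \<le> D * (a + 1)" using cS D0 by (simp add: mult.commute mult_left_mono)
  finally have cZ: "real (card Z) \<le> real (card U) / 2" using D by linarith
  have ZU: "Z \<subseteq> U" by (auto simp: Z_def)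
  define A1 where "A1 = {x \<in> U - Z. {x, y} \<in> E}"
  define A2 where "A2 = {x \<in> U - Z. {x, y} \<notin> E}"
  have "card (A1 \<union> A2) = card A1 + card A2"
    using fin by (intro card_Un_disjoint) (auto simp: A1_def A2_def)
  moreover have "A1 \<union> A2 = U - Z" by (auto simp: A1_def A2_def)
  moreover have "card (U - Z) = card U - card Z" "card Z \<le> card U"
    using ZU fin by (auto simp: card_Diff_subset finite_subset card_mono)
  ultimately have "real (card A1) + real (card A2) = real (card U) - real (card Z)"
    by (metis of_nat_add of_nat_diff)
  then have "real (card A1) \<ge> real (card U) / 4 \<or> real (card A2) \<ge> real (card U) / 4"
    using cZ by linarith
  then have K': "real (card W) \<le> K * real (card A1) \<or> real (card W) \<le> K * real (card A2)"
    using K mult_left_mono[of "real (card U) / 4" _ K] by fastforce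
  have adj: "{y', x} \<in> E \<longleftrightarrow> {x, y} \<in> E" if "y' \<in> S" "x \<in> U - Z" for x y'
    using that by (auto simp: Z_def insert_commute)
  have "lopsided E a K W"
    using K'
  proof
    assume "real (card W) \<le> K * real (card A1)"
    then show ?thesis unfolding lopsided_def
      using S sub cS adj by (intro exI[of _ S] exI[of _ A1]) (auto simp: A1_def)
  next
    assume "real (card W) \<le> K * real (card A2)"
    then show ?thesis unfolding lopsided_def
      using S sub cS adj by (intro exI[of _ S] exI[of _ A2]) (auto simp: A2_def)
  qed
  then show False using lop by contradiction
qed

text \<open>\<open>W\<close> is split into its \<open>u\<close> lightest, its \<open>u\<close>
  heaviest and the \<open>Yn\<close> middle vertices. A good labelling gives many values of
  \<open>y\<close> per index pair, which the chain count converts into points of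
  \<open>Psi\<close>.\<close>

lemma card_Psi_ge:
  fixes a R \<tau> p Hm \<kappa> :: real and G :: "'a ugraph"
  assumes G: "simple_graph G" and W: "W \<subseteq> verts G" "card W = w" and inj: "inj_on \<omega> (verts G)"
    and lop: "\<not> lopsided (edges G) a 32 W" and M: "\<And>x. x \<in> verts G \<Longrightarrow> \<omega> x \<le> M" "M > 0"
    and u: "u = w div 8" "u > 0" and N: "N > 0" and Y: "Yn = w - 2 * u"
    and a: "a > 0" and D: "D > 0" "D * (a + 1) \<le> real u"
    and R: "0 \<le> R" "R \<le> D / 4" and cover: "8 * real N * exp (- (real u / (4 * real N))) < 1"
    and \<tau>: "\<tau> = exp (- (R\<^sup>2 / (8 * real u)))" and p: "p = \<tau> + 2 / sqrt D"
    and Hm: "2 * (1 + ln (real M)) \<le> Hm"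
    and \<kappa>: "\<kappa> = 4 * a + 4 * \<tau> * real Yn + 48 * R * p * Hm + 2 * p * real Yn / real N"
  shows "8 * (real N)\<^sup>2 * real Yn / \<kappa> \<le> (2 * real (2 * u + M) / real Yn + 1) * real (card (Psi G \<omega>))"
proof -
  let ?E = "edges G"
  have finW: "finite W" using G W finite_subset by (auto simp: simple_graph_def)
  have E: "card e = 2" if "e \<in> ?E" for e
    using G that by (auto simp: simple_graph_def nsets_def)
  have injW: "inj_on \<omega> W" using inj W inj_on_subset by blast
  have wu: "8 * u \<le> w" "w < 8 * u + 8" using u by linarith+
  obtain V1 where V1: "V1 \<subseteq> W" "card V1 = u" "\<forall>x\<in>V1. \<forall>y\<in>W - V1. \<omega> x \<le> \<omega> y"
    using ex_lowest_subset[OF finW, of u \<omega>] W wu by auto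
  have cW1: "card (W - V1) = w - u" using V1 W finW by (simp add: card_Diff_subset finite_subset)
  \<comment> \<open>Negated integer weights turn a lowest subset into the heaviest vertices.\<close>
  obtain V2 where V2: "V2 \<subseteq> W - V1" "card V2 = u" "\<forall>x\<in>V2. \<forall>y\<in>W - V1 - V2. - int (\<omega> x) \<le> - int (\<omega> y)"
  proof -
    have "u \<le> card (W - V1)" using cW1 wu u(2) by linarith
    then show ?thesis
      using that ex_lowest_subset[of "W - V1" u "\<lambda>x. - int (\<omega> x)"] finW by blast
  qed
  define Y where "Y = W - V1 - V2"
  have cY: "card Y = Yn"
    unfolding Y_def using V2 finW cW1 Y by (simp add: card_Diff_subset finite_subset)
  have fin: "finite V1" "finite V2" "finite Y" using V1 V2 finW by (auto simp: Y_def intro: finite_subset)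
  have Yn0: "Yn > 0" "6 * u \<le> Yn" using wu u(2) Y by linarith+
  have dis: "V1 \<inter> V2 = {}" "(V1 \<union> V2) \<inter> Y = {}" using V2 by (auto simp: Y_def)
  have YW: "Y \<subseteq> W" "V1 \<union> V2 \<subseteq> W" using V1 V2 by (auto simp: Y_def)
  have cU: "card (V1 \<union> V2) = 2 * u" using fin dis V1 V2 by (simp add: card_Un_disjoint)
  define \<alpha> where "\<alpha> = Max (\<omega> ` V1)"
  have V1ne: "V1 \<noteq> {}" using V1 u by auto
  have low: "\<omega> x \<le> \<alpha>" if "x \<in> V1" for x using that fin by (simp add: \<alpha>_def)
  \<comment> \<open>The \<open>Yn\<close> distinct integer weights of \<open>Y\<close> lie strictly
    between \<open>\<alpha>\<close> and the weights on \<open>V2\<close>, so \<open>Yn\<close>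
    serves as the gap.\<close>
  have high: "\<alpha> + Yn \<le> \<omega> z" if z: "z \<in> V2" for z
  proof -
    obtain x where x: "x \<in> V1" "\<omega> x = \<alpha>" using Max_in[of "\<omega> ` V1"] fin V1ne unfolding \<alpha>_def by fastforce
    have "\<omega> ` Y \<subseteq> {\<alpha><..<\<omega> z}"
    proof clarify
      fix y assume y: "y \<in> Y"
      have "\<omega> x \<le> \<omega> y" using V1(3) x(1) y by (auto simp: Y_def)
      moreover have "\<omega> y \<le> \<omega> z" using V2(3) z y by (auto simp: Y_def)
      moreover have "\<omega> x \<noteq> \<omega> y" "\<omega> y \<noteq> \<omega> z"
        using injW x z y dis YW V1(1) unfolding inj_on_def by blast+
      ultimately show "\<omega> y \<in> {\<alpha><..<\<omega> z}" using x by auto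
    qed
    then have "card (\<omega> ` Y) \<le> \<omega> z - Suc \<alpha>" by (metis card_greaterThanLessThan card_mono finite_greaterThanLessThan)
    moreover have "card (\<omega> ` Y) = Yn"
      using cY injW YW by (metis card_image inj_on_subset)
    ultimately show ?thesis using Yn0 by linarith
  qed
  have \<tau>0: "\<tau> > 0" and p0: "p > 0" using D by (auto simp: \<tau> p add_pos_pos)
  have Hm0: "Hm \<ge> 0" using Hm M(2) by (smt (verit) ln_ge_zero of_nat_1 of_nat_le_iff Suc_leI One_nat_def)
  have \<kappa>0: "\<kappa> > 0"
    unfolding \<kappa> using a \<tau>0 p0 R Hm0 by (intro add_pos_nonneg) auto
  have "\<exists>l. (\<forall>c\<in>{N..<3*N}. (\<exists>x\<in>V1. l x = c) \<and> (\<exists>x\<in>V2. l x = c)) \<and>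
     (\<Sum>i\<in>{N..<3*N}. \<Sum>j\<in>{N..<3*N}. real (card {(y, y') \<in> Y \<times> Y.
        deg ?E ({x \<in> V1. l x < i} \<union> {x \<in> V2. l x < j}) y + \<omega> y
      = deg ?E ({x \<in> V1. l x < i} \<union> {x \<in> V2. l x < j}) y' + \<omega> y'})) \<le> 2 * (real N)\<^sup>2 * card Y * \<kappa>"
  proof (rule ex_labelling[OF fin dis(1) V1(2) V2(2) N _ R D(1) _ _ cover \<tau> p])
    show "inj_on \<omega> Y" using injW YW inj_on_subset by blast
    show "real (card {y' \<in> Y. real (card {x \<in> V1 \<union> V2. ({x, y} \<in> ?E) \<noteq> ({x, y'} \<in> ?E)}) < D}) \<le> a" if "y \<in> Y" for y
    proof (rule less_imp_le, rule card_close_less[OF finW lop YW(2,1) _ a])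
      \<comment> \<open>The constant 32 comes from here: \<open>w < 8u + 8 \<le> 16u\<close> and
        \<open>card (V1 \<union> V2) = 2u\<close>.\<close>
      show "4 * real (card W) \<le> 32 * real (card (V1 \<union> V2))" using W wu u(2) cU by simp
      show "D * (a + 1) \<le> real (card (V1 \<union> V2)) / 2" using D cU by simp
    qed (use dis D that in auto)
    show "(\<Sum>z\<in>Y - {y}. 1 / \<bar>real (\<omega> z) - real (\<omega> y)\<bar>) \<le> Hm" if "y \<in> Y" for y
    proof -
      have "inj_on \<omega> Y" using injW YW inj_on_subset by blast
      then have "(\<Sum>z\<in>Y - {y}. 1 / \<bar>real (\<omega> z) - real (\<omega> y)\<bar>) \<le> 2 * (1 + ln (real M))"
        using that M YW W by (intro sum_inverse_dist_le fin) auto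
      then show ?thesis using Hm by linarith
    qed
    show "\<kappa> = 4 * a + 4 * \<tau> * card Y + 48 * R * p * Hm + 2 * p * card Y / real N" by (simp add: \<kappa> cY)
  qed
  then obtain l where l: "\<And>c. c \<in> {N..<3*N} \<Longrightarrow> (\<exists>x\<in>V1. l x = c) \<and> (\<exists>x\<in>V2. l x = c)"
    and coll: "(\<Sum>i\<in>{N..<3*N}. \<Sum>j\<in>{N..<3*N}. real (card {(y, y') \<in> Y \<times> Y.
        deg ?E ({x \<in> V1. l x < i} \<union> {x \<in> V2. l x < j}) y + \<omega> y
      = deg ?E ({x \<in> V1. l x < i} \<union> {x \<in> V2. l x < j}) y' + \<omega> y'})) \<le> 2 * (real N)\<^sup>2 * card Y * \<kappa>"
    by blast
  define A where "A i = {x \<in> V1. l x < i}" for i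
  define B where "B i = {x \<in> V2. l x < i}" for i
  define f where "f i j y = deg ?E (A i \<union> B j) y + \<omega> y" for i j y
  define cl where "cl i j = real (card {(y, y') \<in> Y \<times> Y. f i j y = f i j y'})" for i j
  have coll': "(\<Sum>i\<in>{N..<3*N}. \<Sum>j\<in>{N..<3*N}. cl i j) \<le> 2 * (real N)\<^sup>2 * Yn * \<kappa>"
    using coll by (simp add: cl_def f_def A_def B_def cY)
  \<comment> \<open>The average number of collisions per index pair is at most
    \<open>c = Yn * \<kappa> / 2\<close>, and \<open>2 t Yn - t^2 c\<close> is largest at
    \<open>t = Yn / c\<close>.\<close>
  let ?t = "2 / \<kappa>"
  have "8 * (real N)\<^sup>2 * Yn / \<kappa> = 4 * (real N)\<^sup>2 * (2 * ?t * Yn) - ?t\<^sup>2 * (2 * (real N)\<^sup>2 * Yn * \<kappa>)"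
    using \<kappa>0 by (simp add: field_simps power2_eq_square)
  also have "\<dots> \<le> 4 * (real N)\<^sup>2 * (2 * ?t * Yn) - ?t\<^sup>2 * (\<Sum>i\<in>{N..<3*N}. \<Sum>j\<in>{N..<3*N}. cl i j)"
    using coll' by (intro diff_left_mono mult_left_mono) auto
  also have "\<dots> = (\<Sum>i\<in>{N..<3*N}. \<Sum>j\<in>{N..<3*N}. 2 * ?t * Yn - ?t\<^sup>2 * cl i j)"
    by (simp add: sum_subtractf sum_distrib_left power2_eq_square)
  also have "\<dots> \<le> (\<Sum>i\<in>{N..<3*N}. \<Sum>j\<in>{N..<3*N}. real (card (f i j ` Y)))"
    unfolding cl_def cY[symmetric] by (intro sum_mono card_image_ge_collisions fin)
  also have "\<dots> \<le> (2 * real (2 * u + M) / real Yn + 1) * real (card (Psi G \<omega>))"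
    unfolding f_def
  proof (rule card_points_ge[OF E fin dis])
    show "A i \<subseteq> V1" "B i \<subseteq> V2" for i by (auto simp: A_def B_def)
    show "A i \<subseteq> A j" "B i \<subseteq> B j" if "i \<le> j" for i j using that by (auto simp: A_def B_def)
    show "A i \<noteq> A (Suc i)" "B i \<noteq> B (Suc i)" if i: "N \<le> i" "i < 3 * N" for i
    proof -
      obtain x1 x2 where "x1 \<in> V1" "l x1 = i" "x2 \<in> V2" "l x2 = i" using l[of i] i by auto
      then have "x1 \<in> A (Suc i)" "x1 \<notin> A i" "x2 \<in> B (Suc i)" "x2 \<notin> B i" by (simp_all add: A_def B_def)
      then show "A i \<noteq> A (Suc i)" "B i \<noteq> B (Suc i)" by blast+
    qed
    show "card V1 + card V2 + \<omega> y \<le> 2 * u + M" if "y \<in> Y" for y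
      using that M YW W V1 V2 by auto
    show "2 * (card V1 + card V2) \<le> Yn" using V1 V2 Yn0 by simp
    show "(card X, val ?E \<omega> X) \<in> Psi G \<omega>" if "X \<subseteq> V1 \<union> V2 \<union> Y" for X
      using that YW W by (intro val_in_Psi) blast
  qed (use low high Yn0 finite_Psi[OF G] in auto)
  finally show ?thesis .
qed

section \<open>Choice of parameters and asymptotics\<close>

theorem theorem4p2:
  fixes C \<delta> \<epsilon> :: real
  assumes "C > 0" and "\<delta> > 0" and "\<epsilon> > 4 * \<delta>"
  shows "\<exists>n0::nat. \<forall>n\<ge>n0. \<forall>(G :: 'a ugraph) (\<omega> :: 'a \<Rightarrow> nat).
           simple_graph G \<and> card (verts G) = n \<and> ramsey_graph C G \<and>
           inj_on \<omega> (verts G) \<and> \<omega> ` verts G \<subseteq> {0..nat \<lfloor>real n powr (1 + \<delta>)\<rfloor>} \<longrightarrow>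
           real (card (Psi G \<omega>)) \<ge> real n powr (3 - \<epsilon>)"
proof -
  \<comment> \<open>The final comparison of exponents needs
    \<open>14 \<eta> \<le> \<epsilon> - \<delta>\<close>, which follows from
    \<open>10 \<eta> \<le> \<delta>\<close> and \<open>\<epsilon> > 4 \<delta>\<close>. The cap
    \<open>1/100\<close> keeps exponents such as \<open>- 1/2 + 5 \<eta>\<close> negative.\<close>
  define \<eta> where "\<eta> = min (\<delta> / 10) (1 / 100)"
  have \<eta>: "0 < \<eta>" "\<eta> \<le> 1/100" "\<delta> > 0" "10 * \<eta> \<le> \<delta>" using assms by (auto simp: \<eta>_def)
  have "\<forall>\<^sub>F n in sequentially. \<forall>(G :: 'a ugraph) (\<omega> :: 'a \<Rightarrow> nat).
           simple_graph G \<and> card (verts G) = n \<and> ramsey_graph C G \<and>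
           inj_on \<omega> (verts G) \<and> \<omega> ` verts G \<subseteq> {0..nat \<lfloor>real n powr (1 + \<delta>)\<rfloor>} \<longrightarrow>
           real (card (Psi G \<omega>)) \<ge> real n powr (3 - \<epsilon>)"
  proof -
    have e0: "\<forall>\<^sub>F n in sequentially. \<forall>G :: 'a ugraph. simple_graph G \<and> card (verts G) = n \<and> ramsey_graph C G \<longrightarrow>
     (\<exists>W\<subseteq>verts G. real n powr (1 - \<eta>) \<le> real (card W) \<and> \<not> lopsided (edges G) (real n powr \<eta>) 32 W)"
      by (rule ramsey_not_lopsided) (use assms \<eta> in auto)
    have e1: "\<forall>\<^sub>F n in sequentially. 8 * real n * exp (- (real n powr \<eta> / 4)) < 1" using \<eta> by real_asymp
    have e2: "\<forall>\<^sub>F n in sequentially. 14 \<le> real n powr (1 - \<eta>)" using \<eta>(1-3) by real_asymp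
    have e3: "\<forall>\<^sub>F n in sequentially. 2 * real n powr \<eta> \<le> real n powr (1 - \<eta>) / 16" using \<eta>(1-3) by real_asymp
    have e4: "\<forall>\<^sub>F n in sequentially. real n powr (1 - 3 * \<eta>) \<le> real n powr (1 - 2 * \<eta>) / 32" using \<eta>(1-3) by real_asymp
    have e5: "\<forall>\<^sub>F n in sequentially. real n powr (1/2 + \<eta>) \<le> real n powr (1 - 2 * \<eta>) / 128" using \<eta>(1-3) by real_asymp
    have e6: "\<forall>\<^sub>F n in sequentially. exp (- (real n powr (2 * \<eta>))) \<le> 1 / real n" using \<eta>(1-3) by real_asymp
    have e7: "\<forall>\<^sub>F n in sequentially. 1 / real n + 12 * real n powr (- 1/2 + \<eta>) \<le> real n powr (- 1/2 + 2 * \<eta>)" using \<eta>(1-3) by real_asymp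
    have e8: "\<forall>\<^sub>F n in sequentially. 2 * (1 + (1 + \<delta>) * ln (real n)) \<le> real n powr \<eta>" using \<eta>(1-3) by real_asymp
    have e9: "\<forall>\<^sub>F n in sequentially. 4 * real n powr \<eta> + 4 + 48 * real n powr (4 * \<eta>) + 2 * real n powr (- 1/2 + 5 * \<eta>) \<le> real n powr (5 * \<eta>)" using \<eta>(1-3) by real_asymp
    have e10: "\<forall>\<^sub>F n in sequentially. 2 * (real n + real n powr (1 + \<delta>)) / (real n powr (1 - \<eta>) / 2) + 1 \<le> real n powr (\<delta> + 2 * \<eta>)" using \<eta>(1-3) by real_asymp
    have e11: "\<forall>\<^sub>F n::nat in sequentially. n \<ge> 1" by (rule eventually_ge_at_top)
    show ?thesis
      using e0 e1 e2 e3 e4 e5 e6 e7 e8 e9 e10 e11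
    proof eventually_elim
      case (elim n)
      show ?case
      proof (intro allI impI)
        fix G :: "'a ugraph" and \<omega> :: "'a \<Rightarrow> nat"
        assume G: "simple_graph G \<and> card (verts G) = n \<and> ramsey_graph C G \<and>
           inj_on \<omega> (verts G) \<and> \<omega> ` verts G \<subseteq> {0..nat \<lfloor>real n powr (1 + \<delta>)\<rfloor>}"
        define x where "x = real n powr \<eta>"
        have n1: "real n \<ge> 1" using elim(12) by simp
        have x1: "x \<ge> 1" using n1 \<eta> by (simp add: x_def ge_one_powr_ge_zero)
        obtain W where W: "W \<subseteq> verts G" "real n powr (1 - \<eta>) \<le> real (card W)" "\<not> lopsided (edges G) x 32 W"
          using elim(1)[rule_format, of G] G unfolding x_def by blast
        define w where "w = card W"
        define u where "u = w div 8"
        define Yn where "Yn = w - 2 * u"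
        \<comment> \<open>Each label then has an expected \<open>u / 4N \<ge> n^\<eta> / 4\<close>
          vertices in either chain part, enough for all middle labels to occur.\<close>
        define N where "N = nat \<lfloor>real u / x\<rfloor>"
        \<comment> \<open>As \<open>x \<ge> 1\<close>, this gives \<open>D (x + 1) \<le> u\<close>,
          the room allowed by the near-twin bound.\<close>
        define D where "D = real u / (2 * x)"
        \<comment> \<open>Since \<open>8u \<le> n\<close>, the exponent \<open>R^2 / (8u)\<close> is
          at least \<open>n^(2\<eta>)\<close>, so \<open>\<tau>\<close> is eventually below
          \<open>1/n\<close>; still \<open>R \<le> D / 4\<close>.\<close>
        define R where "R = real n powr (1/2 + \<eta>)"
        define M where "M = nat \<lfloor>real n powr (1 + \<delta>)\<rfloor>"
        define \<tau> where "\<tau> = exp (- (R\<^sup>2 / (8 * real u)))"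
        define p where "p = \<tau> + 2 / sqrt D"
        \<comment> \<open>Here \<open>x = n^\<eta>\<close> bounds both the number of near-twins and
          the logarithmic sum of inverse distances.\<close>
        define \<kappa> where "\<kappa> = 4 * x + 4 * \<tau> * real Yn + 48 * R * p * x + 2 * p * real Yn / real N"
        have fV: "finite (verts G)" using G by (simp add: simple_graph_def)
        have w: "real n powr (1 - \<eta>) \<le> real w" "real w \<le> real n" "14 \<le> w"
          using W(2) elim(3) card_mono[OF fV W(1)] G by (auto simp: w_def)
        have u8: "8 * u \<le> w" "w \<le> 16 * u" using w(3) by (auto simp: u_def)
        have u: "real n powr (1 - \<eta>) / 16 \<le> real u" "u > 0" using w u8 by linarith+
        have Yn: "real n powr (1 - \<eta>) / 2 \<le> real Yn" "real Yn \<le> real n"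
          using w u8 by (auto simp: Yn_def)
        have ux: "2 * x \<le> real u" using elim(4) u by (simp add: x_def)
        have D0: "D > 0" using u x1 by (simp add: D_def)
        have "real n powr (1 - 2 * \<eta>) / 32 = real n powr (1 - \<eta>) / 16 / (2 * x)"
          using n1 by (simp add: x_def powr_diff[symmetric])
        also have "\<dots> \<le> D" unfolding D_def using u x1 by (intro divide_right_mono) auto
        finally have Dge: "real n powr (1 - 2 * \<eta>) / 32 \<le> D" .
        have N1: "real N \<le> real u / x" "real u / x - 1 < real N"
          using x1 by (auto simp: N_def)
        have "1 \<le> real u / (2 * x)" using ux x1 by (simp add: field_simps)
        moreover have "real u / x = real u / (2 * x) + real u / (2 * x)" by simp
        ultimately have "D \<le> real N" using N1 unfolding D_def by linarith
        then have N2: "real n powr (1 - 3 * \<eta>) \<le> real N" "N > 0" using Dge elim(5) D0 by linarith+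
        have M: "M > 0" "real M \<le> real n powr (1 + \<delta>)"
          using n1 \<eta> ge_one_powr_ge_zero[of "real n" "1 + \<delta>"] by (auto simp: M_def)
        have R2: "R \<le> D / 4" using elim(6) Dge by (simp add: R_def)
        have \<tau>le: "\<tau> \<le> 1 / real n"
        proof -
          have "R\<^sup>2 = real n powr (1 + 2 * \<eta>)"
            by (simp add: R_def power2_eq_square powr_add[symmetric])
          also have "\<dots> = real n * real n powr (2 * \<eta>)" using n1 by (simp add: powr_add)
          finally have "real n powr (2 * \<eta>) = R\<^sup>2 / real n" using n1 by simp
          also have "\<dots> \<le> R\<^sup>2 / (8 * real u)" using u u8 w by (intro divide_left_mono) auto
          finally have "\<tau> \<le> exp (- (real n powr (2 * \<eta>)))" by (simp add: \<tau>_def)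
          then show ?thesis using elim(7) by linarith
        qed
        have ple: "p \<le> real n powr (- 1/2 + 2 * \<eta>)"
        proof -
          have "(real n powr (1/2 - \<eta>) / 6)\<^sup>2 = real n powr (1 - 2 * \<eta>) / 36"
            by (simp add: power_divide power2_eq_square powr_add[symmetric])
          also have "\<dots> \<le> real n powr (1 - 2 * \<eta>) / 32" by simp
          also have "\<dots> \<le> D" by (rule Dge)
          finally have "real n powr (1/2 - \<eta>) / 6 \<le> sqrt D" by (rule real_le_rsqrt)
          then have "2 / sqrt D \<le> 2 / (real n powr (1/2 - \<eta>) / 6)"
            using n1 D0 by (intro divide_left_mono) auto
          also have "\<dots> = 12 / real n powr (1/2 - \<eta>)" by simp
          also have "\<dots> = 12 * real n powr (- (1/2 - \<eta>))" unfolding powr_minus by (rule divide_inverse)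
          also have "- (1/2 - \<eta>) = - 1/2 + \<eta>" by simp
          finally show ?thesis using \<tau>le elim(8) unfolding p_def by linarith
        qed
        have \<tau>0: "\<tau> > 0" and p0: "p > 0" using D0 by (auto simp: \<tau>_def p_def add_pos_pos)
        have \<kappa>le: "\<kappa> \<le> real n powr (5 * \<eta>)"
        proof -
          have "\<tau> * real Yn \<le> (1 / real n) * real n" using \<tau>le \<tau>0 Yn by (intro mult_mono) auto
          then have k1: "4 * \<tau> * real Yn \<le> 4" using n1 by simp
          have "48 * R * p * x \<le> 48 * R * real n powr (- 1/2 + 2 * \<eta>) * x"
            using ple x1 by (intro mult_left_mono mult_right_mono) (auto simp: R_def)
          also have "\<dots> = 48 * real n powr (4 * \<eta>)"
            by (simp add: R_def x_def powr_add[symmetric] flip: mult.assoc)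
          finally have k2: "48 * R * p * x \<le> 48 * real n powr (4 * \<eta>)" .
          have "2 * p * real Yn / real N \<le> 2 * real n powr (- 1/2 + 2 * \<eta>) * real n / real n powr (1 - 3 * \<eta>)"
            using ple p0 Yn N2 n1 by (intro frac_le mult_mono) auto
          also have "\<dots> = 2 * (real n powr (- 1/2 + 2 * \<eta>) * real n powr 1 / real n powr (1 - 3 * \<eta>))"
            using n1 by simp
          also have "\<dots> = 2 * real n powr ((- 1/2 + 2 * \<eta>) + 1 - (1 - 3 * \<eta>))"
            by (simp only: powr_add powr_diff)
          also have "(- 1/2 + 2 * \<eta>) + 1 - (1 - 3 * \<eta>) = - 1/2 + 5 * \<eta>" by simp
          finally have k3: "2 * p * real Yn / real N \<le> 2 * real n powr (- 1/2 + 5 * \<eta>)" .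
          show ?thesis using elim(10) k1 k2 k3 unfolding \<kappa>_def x_def by linarith
        qed
        have \<kappa>0: "\<kappa> > 0"
          unfolding \<kappa>_def using x1 \<tau>0 p0 by (intro add_pos_nonneg) (auto simp: R_def)
        have main: "8 * (real N)\<^sup>2 * real Yn / \<kappa> \<le> (2 * real (2 * u + M) / real Yn + 1) * real (card (Psi G \<omega>))"
        proof (rule card_Psi_ge[OF _ W(1) w_def[symmetric] _ W(3) _ M(1) u_def u(2) N2(2) Yn_def _ D0 _ _ R2 _ \<tau>_def p_def _ \<kappa>_def])
          show "\<omega> v \<le> M" if "v \<in> verts G" for v using G that by (auto simp: M_def)
          show "D * (x + 1) \<le> real u" using x1 mult_right_mono[of 1 x "real u"] by (simp add: D_def field_simps)
          show "8 * real N * exp (- (real u / (4 * real N))) < 1"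
          proof -
            have "x \<le> real u / real N" using N1(1) N2 x1 by (simp add: field_simps)
            then have "exp (- (real u / (4 * real N))) \<le> exp (- (x / 4))" by simp
            moreover have "real u / x \<le> real u / 1" using x1 by (intro divide_left_mono) auto
            then have "real N \<le> real n" using N1(1) u8 w(2) by linarith
            ultimately have "8 * real N * exp (- (real u / (4 * real N))) \<le> 8 * real n * exp (- (x / 4))"
              by (intro mult_mono) auto
            then show ?thesis using elim(2) by (simp add: x_def)
          qed
          show "2 * (1 + ln (real M)) \<le> x"
          proof -
            have "ln (real M) \<le> ln (real n powr (1 + \<delta>))"
              using M n1 by (intro ln_le_cancel_iff[THEN iffD2]) auto
            also have "\<dots> = (1 + \<delta>) * ln (real n)" using n1 by (simp add: ln_powr)
            finally have "2 * (1 + ln (real M)) \<le> 2 * (1 + (1 + \<delta>) * ln (real n))" by simp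
            then show ?thesis using elim(9) unfolding x_def by (rule order_trans)
          qed
        qed (use G x1 in \<open>auto simp: R_def\<close>)
        \<comment> \<open>Inserting the bounds for \<open>N\<close>, \<open>Yn\<close> and
          \<open>\<kappa>\<close> gives the exponent
          \<open>2 (1 - 3\<eta>) + (1 - \<eta>) - 5\<eta>\<close>.\<close>
        have "4 * real n powr (3 - 12 * \<eta>) = 8 * (real n powr (1 - 3 * \<eta>))\<^sup>2 * (real n powr (1 - \<eta>) / 2) / real n powr (5 * \<eta>)"
        proof -
          have "3 - 12 * \<eta> = (1 - 3 * \<eta>) + (1 - 3 * \<eta>) + (1 - \<eta>) - 5 * \<eta>" by simp
          then have "real n powr (3 - 12 * \<eta>) = real n powr (1 - 3 * \<eta>) * real n powr (1 - 3 * \<eta>)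
              * real n powr (1 - \<eta>) / real n powr (5 * \<eta>)"
            by (simp only: powr_add powr_diff)
          then show ?thesis by (simp add: power2_eq_square)
        qed
        also have "\<dots> \<le> 8 * (real N)\<^sup>2 * real Yn / \<kappa>"
          using N2 Yn \<kappa>le \<kappa>0 by (intro frac_le mult_mono power_mono) auto
        also note main
        \<comment> \<open>The multiplicity of a point: weights up to \<open>n^(1 + \<delta>)\<close>
          against a gap of at least \<open>n^(1 - \<eta>) / 2\<close>.\<close>
        also have "2 * real (2 * u + M) / real Yn + 1 \<le> real n powr (\<delta> + 2 * \<eta>)"
        proof -
          have "2 * real (2 * u + M) / real Yn \<le> 2 * (real n + real n powr (1 + \<delta>)) / (real n powr (1 - \<eta>) / 2)"
            using Yn M u8 w n1 by (intro frac_le) auto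
          then show ?thesis using elim(11) by linarith
        qed
        finally have "4 * real n powr (3 - 12 * \<eta>) \<le> real n powr (\<delta> + 2 * \<eta>) * real (card (Psi G \<omega>))"
          by (simp add: mult_right_mono)
        moreover have "real n powr (\<delta> + 2 * \<eta>) * real n powr (3 - \<epsilon>) \<le> 4 * real n powr (3 - 12 * \<eta>)"
        proof -
          have "real n powr (\<delta> + 2 * \<eta>) * real n powr (3 - \<epsilon>) = real n powr (\<delta> + 2 * \<eta> + (3 - \<epsilon>))"
            by (simp only: powr_add)
          also have "\<dots> \<le> real n powr (3 - 12 * \<eta>)" using n1 \<eta> assms by (intro powr_mono) auto
          finally show ?thesis using powr_ge_zero[of "real n" "3 - 12 * \<eta>"] by linarith
        qed
        ultimately have "real n powr (\<delta> + 2 * \<eta>) * real n powr (3 - \<epsilon>) \<le> real n powr (\<delta> + 2 * \<eta>) * real (card (Psi G \<omega>))"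
          by linarith
        then show "real n powr (3 - \<epsilon>) \<le> real (card (Psi G \<omega>))"
          using n1 by (simp add: mult_le_cancel_left_pos)
      qed
    qed
  qed
  then show ?thesis by (simp only: eventually_sequentially)
qed

end
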